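(* Assume Martin's Axiom (MA). Let $(X,\mu)$ be a standard non-atomic Borel probability space and $G$ a group. Then every measure preserving near-action of $G$ on $(X,\mu)$ has a spatial model.
   Context: A measure preserving near-action of $G$ is a map $\eta:G\times X\to X$, writing $\eta(g)(x)=\eta(g,x)$, such that: (1) $\eta(e)(x)=x$ for almost all $x$; (2) for all $g,h\in G$, $\eta(gh)(x)=\eta(g)(\eta(h)(x))$ for almost all $x$; (3) for every Borel $B\subseteq X$ and $g\in G$, $\eta(g)(B)$ is $\mu$-measurable and $\mu(\eta(g)(B))=\mu(B)$. A spatial model of $\eta$ is an action $\rho:G\times X\to X$ of $G$ on $X$ in the usual sense which is measure preserving (for every Borel $B$ and $g\in G$, $\rho(g)(B)$ is $\mu$-measurable and $\mu(\rho(g)(B))=\mu(B)$) and such that for each $g\in G$, $\eta(g,x)=\rho(g,x)$ for $\mu$-a.e. $x$. *)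

theory Defs
  imports
    "HOL-Probability.Probability"
    "HOL-Algebra.Group_Action"
    "HOL-Library.Equipollence"
begin

section \<open>Martin's Axiom\<close>

text \<open>
  A forcing poset is a carrier \<open>P\<close> with a partial order \<open>r\<close>, where \<open>(p, q) \<in> r\<close> means that
  \<open>p\<close> is below (is stronger than) \<open>q\<close>.
\<close>

definition compatible :: "'p set \<Rightarrow> 'p rel \<Rightarrow> 'p \<Rightarrow> 'p \<Rightarrow> bool" where
  "compatible P r p q \<longleftrightarrow> (\<exists>s\<in>P. (s, p) \<in> r \<and> (s, q) \<in> r)"

definition ccc_poset :: "'p set \<Rightarrow> 'p rel \<Rightarrow> bool" where
  "ccc_poset P r \<longleftrightarrow> partial_order_on P r \<and>
     (\<forall>A\<subseteq>P. (\<forall>p\<in>A. \<forall>q\<in>A. p \<noteq> q \<longrightarrow> \<not> compatible P r p q) \<longrightarrow> countable A)"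

definition dense_in_poset :: "'p set \<Rightarrow> 'p rel \<Rightarrow> 'p set \<Rightarrow> bool" where
  "dense_in_poset P r D \<longleftrightarrow> D \<subseteq> P \<and> (\<forall>p\<in>P. \<exists>d\<in>D. (d, p) \<in> r)"

definition poset_filter :: "'p set \<Rightarrow> 'p rel \<Rightarrow> 'p set \<Rightarrow> bool" where
  "poset_filter P r F \<longleftrightarrow> F \<subseteq> P \<and> F \<noteq> {} \<and>
     (\<forall>p\<in>F. \<forall>q\<in>F. \<exists>s\<in>F. (s, p) \<in> r \<and> (s, q) \<in> r) \<and>
     (\<forall>p\<in>F. \<forall>q\<in>P. (p, q) \<in> r \<longrightarrow> q \<in> F)"

text \<open>
  A HOL formula cannot quantify over all types, so the axiom is stated for the posets carried by
  subsets of a given type. The lemma \<open>martins_axiom_any_type\<close> below shows that the instance for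
  the type of real numbers implies the instance for every type, so that \<open>martins_axiom TYPE(real)\<close>
  is Martin's Axiom for arbitrary ccc posets.
\<close>

definition martins_axiom :: "'p itself \<Rightarrow> bool" where
  "martins_axiom _ \<longleftrightarrow>
     (\<forall>(P :: 'p set) r \<D>. P \<noteq> {} \<and> ccc_poset P r \<and> (\<forall>D\<in>\<D>. dense_in_poset P r D) \<and>
        \<D> \<prec> (UNIV :: real set) \<longrightarrow>
        (\<exists>F. poset_filter P r F \<and> (\<forall>D\<in>\<D>. F \<inter> D \<noteq> {})))"

lemma small_closure:
  fixes p :: 'p and f :: "'p \<Rightarrow> 'p \<Rightarrow> 'p" and g :: "'i \<Rightarrow> 'p \<Rightarrow> 'p"
  assumes "I \<prec> (UNIV :: real set)"
  obtains Q where "p \<in> Q" "\<And>x y. x \<in> Q \<Longrightarrow> y \<in> Q \<Longrightarrow> f x y \<in> Q"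
    "\<And>i x. i \<in> I \<Longrightarrow> x \<in> Q \<Longrightarrow> g i x \<in> Q" "Q \<lesssim> (UNIV :: real set)"
proof -
  define S where "S = rec_nat {p} (\<lambda>_ A. A \<union> (\<lambda>(x, y). f x y) ` (A \<times> A) \<union> (\<lambda>(i, x). g i x) ` (I \<times> A))"
  have S0: "S 0 = {p}"
    and SS: "S (Suc n) = S n \<union> (\<lambda>(x, y). f x y) ` (S n \<times> S n) \<union> (\<lambda>(i, x). g i x) ` (I \<times> S n)" for n
    by (simp_all add: S_def)
  let ?R = "card_of (UNIV :: real set)"
  have inf: "\<not> finite (UNIV :: real set)"
    by (simp add: infinite_UNIV_char_0)
  have co: "\<not> finite (Field ?R)" "Card_order ?R"
    using inf card_of_Card_order by (simp_all only: Field_card_of not_False_eq_True)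
  have I: "ordLeq3 (card_of I) ?R"
    using assms by (meson card_of_ordLeq lepoll_def lesspoll_def)
  have n: "ordLeq3 (card_of (S n)) ?R" for n
  proof (induction n)
    case 0
    show ?case
      unfolding S0 by (simp add: card_of_singl_ordLeq)
  next
    case (Suc n)
    have "ordLeq3 (card_of (S n \<times> S n)) ?R" "ordLeq3 (card_of (I \<times> S n)) ?R"
      using Suc I co by (simp_all add: card_of_Times_ordLeq_infinite_Field)
    then show ?case
      unfolding SS
      by (intro card_of_Un_ordLeq_infinite_Field co Suc)
         (auto intro: ordLeq_transitive[OF card_of_image])
  qed
  have mono: "S m \<subseteq> S n" if "m \<le> n" for m n
    using that by (rule lift_Suc_mono_le[rotated]) (auto simp: SS)
  define Q where "Q = (\<Union>n. S n)"
  show ?thesis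
  proof (rule that[of Q])
    show "p \<in> Q"
      using S0 by (auto simp: Q_def)
    show "f x y \<in> Q" if "x \<in> Q" "y \<in> Q" for x y
    proof -
      from that obtain m k where "x \<in> S m" "y \<in> S k"
        by (auto simp: Q_def)
      then have "x \<in> S (max m k)" "y \<in> S (max m k)"
        using mono by (meson max.cobounded1 max.cobounded2 subsetD)+
      then have "f x y \<in> S (Suc (max m k))"
        by (auto simp: SS)
      then show ?thesis
        by (auto simp: Q_def)
    qed
    show "g i x \<in> Q" if "i \<in> I" "x \<in> Q" for i x
    proof -
      from that obtain m where "x \<in> S m"
        by (auto simp: Q_def)
      then have "g i x \<in> S (Suc m)"
        using that by (auto simp: SS)
      then show ?thesis
        by (auto simp: Q_def)
    qed
    have "ordLeq3 (card_of (UNIV :: nat set)) ?R"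
      using inf infinite_iff_card_of_nat by blast
    then have "ordLeq3 (card_of Q) ?R"
      unfolding Q_def using n by (intro card_of_UNION_ordLeq_infinite inf) auto
    then show "Q \<lesssim> (UNIV :: real set)"
      by (meson card_of_ordLeq lepoll_def)
  qed
qed

lemma martins_axiom_any_type:
  assumes "martins_axiom TYPE(real)"
  shows "martins_axiom TYPE('p)"
  unfolding martins_axiom_def
proof (intro allI impI, elim conjE)
  fix P :: "'p set" and r \<D>
  assume ne: "P \<noteq> {}" and ccc: "ccc_poset P r" and dense: "\<forall>D\<in>\<D>. dense_in_poset P r D"
    and small: "\<D> \<prec> (UNIV :: real set)"
  have po: "r \<subseteq> P \<times> P" "refl_on P r" "trans r" "antisym r"
    using ccc by (auto simp: ccc_poset_def partial_order_on_def preorder_on_def)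
  obtain p0 where p0: "p0 \<in> P"
    using ne by blast
  define low where "low p q = (if compatible P r p q then SOME s. s \<in> P \<and> (s, p) \<in> r \<and> (s, q) \<in> r else p0)" for p q
  define sel where "sel D p = (if p \<in> P then SOME d. d \<in> D \<and> (d, p) \<in> r else p0)" for D p
  have low: "low p q \<in> P \<and> (low p q, p) \<in> r \<and> (low p q, q) \<in> r" if "compatible P r p q" for p q
    using that someI_ex[of "\<lambda>s. s \<in> P \<and> (s, p) \<in> r \<and> (s, q) \<in> r"]
    by (auto simp: low_def compatible_def)
  have sel: "sel D p \<in> D \<and> (sel D p, p) \<in> r" if "D \<in> \<D>" "p \<in> P" for D p
  proof -
    have "\<exists>d. d \<in> D \<and> (d, p) \<in> r"
      using dense that unfolding dense_in_poset_def by blast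
    from someI_ex[OF this] show ?thesis
      using that by (simp add: sel_def)
  qed
  obtain Q0 where Q0: "p0 \<in> Q0" "\<And>x y. x \<in> Q0 \<Longrightarrow> y \<in> Q0 \<Longrightarrow> low x y \<in> Q0"
    "\<And>D x. D \<in> \<D> \<Longrightarrow> x \<in> Q0 \<Longrightarrow> sel D x \<in> Q0" "Q0 \<lesssim> (UNIV :: real set)"
    using small_closure[OF small, of p0 low sel] by blast
  define Q where "Q = Q0 \<inter> P"
  have QP: "Q \<subseteq> P"
    by (auto simp: Q_def)
  have Qlow: "low x y \<in> Q" if "x \<in> Q" "y \<in> Q" "compatible P r x y" for x y
    using that Q0(2) low by (auto simp: Q_def)
  have Qsel: "sel D x \<in> Q" if "D \<in> \<D>" "x \<in> Q" for D x
    using that Q0(3) sel po by (fastforce simp: Q_def)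
  have "Q \<lesssim> (UNIV :: real set)"
    unfolding Q_def by (rule lepoll_trans[OF subset_imp_lepoll Q0(4)]) simp
  then obtain f :: "'p \<Rightarrow> real" where f: "inj_on f Q"
    by (auto simp: lepoll_def)
  define r' where "r' = {(f x, f y) |x y. x \<in> Q \<and> y \<in> Q \<and> (x, y) \<in> r}"
  define \<D>' where "\<D>' = (\<lambda>D. f ` (D \<inter> Q)) ` \<D>"
  have r': "(f x, f y) \<in> r' \<longleftrightarrow> (x, y) \<in> r" if "x \<in> Q" "y \<in> Q" for x y
    using that f by (auto simp: r'_def inj_on_def)
  have r'_sub: "r' \<subseteq> f ` Q \<times> f ` Q"
    by (auto simp: r'_def)
  have "refl_on (f ` Q) r'"
    using po(2) QP by (auto simp: refl_on_def r')
  moreover have "trans r'"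
  proof (rule transI)
    fix a b c assume "(a, b) \<in> r'" "(b, c) \<in> r'"
    moreover from this obtain x y z where "a = f x" "b = f y" "c = f z" "x \<in> Q" "y \<in> Q" "z \<in> Q"
      using r'_sub by blast
    ultimately show "(a, c) \<in> r'"
      using po(3) by (auto simp: r' dest: transD)
  qed
  moreover have "antisym r'"
  proof (rule antisymI)
    fix a b assume "(a, b) \<in> r'" "(b, a) \<in> r'"
    moreover from this obtain x y where "a = f x" "b = f y" "x \<in> Q" "y \<in> Q"
      using r'_sub by blast
    ultimately show "a = b"
      using po(4) by (auto simp: r' dest: antisymD)
  qed
  ultimately have po': "partial_order_on (f ` Q) r'"
    using r'_sub by (auto simp: partial_order_on_def preorder_on_def)
  have compat: "compatible (f ` Q) r' (f x) (f y)" if "x \<in> Q" "y \<in> Q" "compatible P r x y" for x y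
    using Qlow[OF that] low[OF that(3)] that by (auto simp: compatible_def r')
  have ccc': "ccc_poset (f ` Q) r'"
    unfolding ccc_poset_def
  proof (intro conjI allI impI po')
    fix A assume A: "A \<subseteq> f ` Q" "\<forall>p\<in>A. \<forall>q\<in>A. p \<noteq> q \<longrightarrow> \<not> compatible (f ` Q) r' p q"
    define B where "B = {x \<in> Q. f x \<in> A}"
    have "\<forall>p\<in>B. \<forall>q\<in>B. p \<noteq> q \<longrightarrow> \<not> compatible P r p q"
    proof (intro ballI impI notI)
      fix p q assume *: "p \<in> B" "q \<in> B" "p \<noteq> q" "compatible P r p q"
      then have "f p \<noteq> f q"
        using f by (auto simp: B_def inj_on_def)
      then show False
        using * A(2) compat by (auto simp: B_def)
    qed
    moreover have "B \<subseteq> P"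
      using QP by (auto simp: B_def)
    ultimately have "countable B"
      using ccc by (auto simp: ccc_poset_def)
    moreover have "A = f ` B"
      using A(1) by (auto simp: B_def)
    ultimately show "countable A"
      by simp
  qed
  have dense': "\<forall>D\<in>\<D>'. dense_in_poset (f ` Q) r' D"
  proof
    fix D' assume "D' \<in> \<D>'"
    then obtain D where D: "D \<in> \<D>" "D' = f ` (D \<inter> Q)"
      by (auto simp: \<D>'_def)
    have "\<exists>d\<in>D'. (d, f x) \<in> r'" if "x \<in> Q" for x
      using Qsel[OF D(1) that] sel[OF D(1)] that QP D(2)
      by (intro bexI[of _ "f (sel D x)"]) (auto simp: r')
    then show "dense_in_poset (f ` Q) r' D'"
      using D(2) by (auto simp: dense_in_poset_def)
  qed
  have "\<D>' \<prec> (UNIV :: real set)"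
    unfolding \<D>'_def using small image_lepoll lesspoll_trans1 by blast
  moreover have "f ` Q \<noteq> {}"
    using Q0(1) p0 by (auto simp: Q_def)
  ultimately obtain F' where F': "poset_filter (f ` Q) r' F'" "\<forall>D\<in>\<D>'. F' \<inter> D \<noteq> {}"
    using assms ccc' dense' unfolding martins_axiom_def by meson
  define F where "F = {p \<in> P. \<exists>q\<in>Q. f q \<in> F' \<and> (q, p) \<in> r}"
  have F'Q: "F' \<subseteq> f ` Q"
    using F'(1) by (auto simp: poset_filter_def)
  have QF: "q \<in> F" if "q \<in> Q" "f q \<in> F'" for q
    using that QP po(2) by (auto simp: F_def refl_on_def)
  have "poset_filter P r F"
    unfolding poset_filter_def
  proof (intro conjI ballI impI)
    show "F \<subseteq> P"
      by (auto simp: F_def)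
    show "F \<noteq> {}"
      using F'(1) F'Q QF by (fastforce simp: poset_filter_def)
    show "\<exists>s\<in>F. (s, p) \<in> r \<and> (s, q) \<in> r" if pq: "p \<in> F" "q \<in> F" for p q
    proof -
      obtain x y where xy: "x \<in> Q" "f x \<in> F'" "(x, p) \<in> r" "y \<in> Q" "f y \<in> F'" "(y, q) \<in> r"
        using pq by (auto simp: F_def)
      then obtain s' where "s' \<in> F'" "(s', f x) \<in> r'" "(s', f y) \<in> r'"
        using F'(1) unfolding poset_filter_def by blast
      moreover from this obtain s where "s' = f s" "s \<in> Q"
        using F'Q by blast
      ultimately show ?thesis
        using xy QF[of s] po(3) by (auto simp: r' intro!: bexI[of _ s] dest: transD)
    qed
    show "q \<in> F" if "p \<in> F" "q \<in> P" "(p, q) \<in> r" for p q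
      using that po(3) unfolding F_def by (blast dest: transD)
  qed
  moreover have "\<forall>D\<in>\<D>. F \<inter> D \<noteq> {}"
  proof
    fix D assume "D \<in> \<D>"
    then have "F' \<inter> f ` (D \<inter> Q) \<noteq> {}"
      using F'(2) by (auto simp: \<D>'_def)
    then show "F \<inter> D \<noteq> {}"
      using QF by blast
  qed
  ultimately show "\<exists>F. poset_filter P r F \<and> (\<forall>D\<in>\<D>. F \<inter> D \<noteq> {})"
    by blast
qed

section \<open>Standard non-atomic Borel probability spaces\<close>

definition polish_topology :: "'x topology \<Rightarrow> bool" where
  "polish_topology T \<longleftrightarrow> completely_metrizable_space T \<and> separable_space T"

definition standard_borel :: "'x measure \<Rightarrow> bool" where
  "standard_borel M \<longleftrightarrow>
     (\<exists>T. polish_topology T \<and> topspace T = space M \<and>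
          sets M = sigma_sets (space M) {U. openin T U})"

definition non_atomic :: "'x measure \<Rightarrow> bool" where
  "non_atomic M \<longleftrightarrow>
     (\<forall>A\<in>sets M. emeasure M A > 0 \<longrightarrow>
        (\<exists>B\<in>sets M. B \<subseteq> A \<and> 0 < emeasure M B \<and> emeasure M B < emeasure M A))"

section \<open>Near-actions and spatial models\<close>

text \<open>
  The \<open>\<mu>\<close>-measurable sets are the measurable sets of the completion of \<open>\<mu>\<close>. The condition is about
  forward images of Borel sets; no measurability of the map itself is required.
\<close>

definition image_measure_preserving :: "'x measure \<Rightarrow> ('x \<Rightarrow> 'x) \<Rightarrow> bool" where
  "image_measure_preserving M f \<longleftrightarrow>
     (\<forall>B\<in>sets M. f ` B \<in> sets (completion M) \<and> emeasure (completion M) (f ` B) = emeasure M B)"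

definition measure_preserving_near_action ::
  "('g, 'b) monoid_scheme \<Rightarrow> 'x measure \<Rightarrow> ('g \<Rightarrow> 'x \<Rightarrow> 'x) \<Rightarrow> bool" where
  "measure_preserving_near_action G M \<eta> \<longleftrightarrow>
     (\<forall>g\<in>carrier G. \<eta> g \<in> space M \<rightarrow> space M) \<and>
     (AE x in M. \<eta> \<one>\<^bsub>G\<^esub> x = x) \<and>
     (\<forall>g\<in>carrier G. \<forall>h\<in>carrier G. AE x in M. \<eta> (g \<otimes>\<^bsub>G\<^esub> h) x = \<eta> g (\<eta> h x)) \<and>
     (\<forall>g\<in>carrier G. image_measure_preserving M (\<eta> g))"

definition spatial_model ::
  "('g, 'b) monoid_scheme \<Rightarrow> 'x measure \<Rightarrow> ('g \<Rightarrow> 'x \<Rightarrow> 'x) \<Rightarrow> ('g \<Rightarrow> 'x \<Rightarrow> 'x) \<Rightarrow> bool" where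
  "spatial_model G M \<eta> \<rho> \<longleftrightarrow>
     group_action G (space M) \<rho> \<and>
     (\<forall>g\<in>carrier G. image_measure_preserving M (\<rho> g)) \<and>
     (\<forall>g\<in>carrier G. AE x in M. \<eta> g x = \<rho> g x)"

end

theory Submission
  imports Defs "HOL-Algebra.Generated_Groups" "HOL-Algebra.Divisibility"
begin

text \<open>
  Dividing out the elements that act trivially almost everywhere, one may assume that \<open>G\<close> has at
  most continuum many elements, because a near-automorphism is determined up to null sets by
  countably many events. Write \<open>G\<close> as the union of a chain of subgroups \<open>H\<close> of size below the
  continuum. Under MA a union of fewer than continuum many null sets is null, so each \<open>H\<close> acts
  genuinely at almost every point; moreover the \<open>H\<close>-orbit of such a point may be required to avoid a
  fixed null set \<open>N\<close> of size continuum. The points at which some member of the chain acts genuinely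
  thus carry a partial action of \<open>G\<close> in which only a subgroup acts at each point. The \<open>G\<close>-sets induced
  from its orbits extend it to an action of \<open>G\<close>, and their new points can be placed in \<open>N\<close>, since
  nothing is prescribed there.
\<close>

section \<open>Cardinalities of generated subgroups\<close>

lemma lepoll_iff_card_of_ordLeq: "A \<lesssim> B \<longleftrightarrow> ordLeq3 (card_of A) (card_of B)"
  by (simp add: lepoll_def card_of_ordLeq)

lemma lesspoll_iff_card_of_ordLess: "A \<prec> B \<longleftrightarrow> ordLess2 (card_of A) (card_of B)"
  unfolding lesspoll_def eqpoll_iff_card_of_ordIso lepoll_iff_card_of_ordLeq
  using ordLeq_iff_ordLess_or_ordIso not_ordLess_ordIso by blast

lemma Times_lepoll_infinite:
  assumes "infinite K" "A \<lesssim> K" "B \<lesssim> K"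
  shows "A \<times> B \<lesssim> K"
  using assms unfolding lepoll_iff_card_of_ordLeq by (intro card_of_Sigma_ordLeq_infinite) auto

lemma lists_lepoll_infinite:
  assumes K: "infinite K" and A: "A \<lesssim> K"
  shows "lists A \<lesssim> K"
proof -
  have "{xs \<in> lists A. length xs = n} \<lesssim> K" for n
  proof (induction n)
    case 0
    have "{[]} \<lesssim> K"
      using K by (intro finite_lepoll_infinite) auto
    then show ?case
      by (rule lepoll_trans[OF subset_imp_lepoll, rotated]) auto
  next
    case (Suc n)
    have "{xs \<in> lists A. length xs = Suc n}
      \<subseteq> (\<lambda>(x, xs). x # xs) ` (A \<times> {xs \<in> lists A. length xs = n})"
      by (auto simp: length_Suc_conv)
    then show ?case
      using Times_lepoll_infinite[OF K A Suc] by (meson subset_image_lepoll lepoll_trans)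
  qed
  then have "(\<Union>n. {xs \<in> lists A. length xs = n}) \<lesssim> K"
    using K unfolding lepoll_iff_card_of_ordLeq infinite_iff_card_of_nat
    by (intro card_of_UNION_ordLeq_infinite) (auto simp: infinite_iff_card_of_nat)
  then show ?thesis
    by (rule lepoll_trans[OF subset_imp_lepoll, rotated]) auto
qed

lemma insert_lesspoll_infinite:
  assumes "infinite K" "A \<prec> K"
  shows "insert a A \<prec> K"
proof (cases "finite A")
  case True
  then show ?thesis
    using assms(1) by (intro finite_lesspoll_infinite) auto
next
  case False
  then show ?thesis
    by (rule eq_lesspoll_trans[OF infinite_insert_eqpoll assms(2)])
qed

lemma (in monoid) multlist_append:
  assumes "set xs \<subseteq> carrier G" "set ys \<subseteq> carrier G"
  shows "foldr (\<otimes>) (xs @ ys) \<one> = foldr (\<otimes>) xs \<one> \<otimes> foldr (\<otimes>) ys \<one>"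
  using assms by (induction xs) (auto simp: m_assoc)

context group
begin

lemma generate_subset_multlist:
  assumes A: "A \<subseteq> carrier G"
  shows "generate G A \<subseteq> (\<lambda>xs. foldr (\<otimes>) xs \<one>) ` lists (A \<union> m_inv G ` A)" (is "_ \<subseteq> ?eval ` lists ?S")
proof
  fix g assume "g \<in> generate G A"
  then show "g \<in> ?eval ` lists ?S"
  proof (induction rule: generate.induct)
    case one
    show ?case
      by (rule image_eqI[of _ _ "[]"]) auto
  next
    case (incl h)
    then show ?case
      using A by (intro image_eqI[of _ _ "[h]"]) auto
  next
    case (inv h)
    then show ?case
      using A by (intro image_eqI[of _ _ "[inv h]"]) auto
  next
    case (eng g h)
    then obtain xs ys where "xs \<in> lists ?S" "g = ?eval xs" "ys \<in> lists ?S" "h = ?eval ys"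
      by blast
    moreover from this have "set xs \<subseteq> carrier G" "set ys \<subseteq> carrier G"
      using A by (auto simp: in_lists_conv_set)
    ultimately show ?case
      by (intro image_eqI[of _ _ "xs @ ys"]) (auto simp: multlist_append simp del: foldr_append)
  qed
qed

lemma generate_lepoll_infinite:
  assumes "infinite K" "A \<subseteq> carrier G" "A \<lesssim> K"
  shows "generate G A \<lesssim> K"
proof -
  have "m_inv G ` A \<lesssim> K"
    using image_lepoll assms(3) lepoll_trans by blast
  then have "A \<union> m_inv G ` A \<lesssim> K"
    using assms(1,3) unfolding lepoll_iff_card_of_ordLeq
    by (intro card_of_Un_ordLeq_infinite_Field) (simp_all add: Field_card_of card_of_card_order_on)
  then have "lists (A \<union> m_inv G ` A) \<lesssim> K"
    by (rule lists_lepoll_infinite[OF assms(1)])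
  then show ?thesis
    using generate_subset_multlist[OF assms(2)] by (meson subset_image_lepoll lepoll_trans)
qed

lemma generate_lesspoll_uncountable:
  assumes K: "uncountable K" and A: "A \<subseteq> carrier G" "A \<prec> K"
  shows "generate G A \<prec> K"
proof (cases "finite A")
  case True
  then have "generate G A \<lesssim> (UNIV :: nat set)"
    using A(1) by (intro generate_lepoll_infinite finite_lepoll_infinite) auto
  also have "(UNIV :: nat set) \<prec> K"
    unfolding lesspoll_def
  proof
    show "(UNIV :: nat set) \<lesssim> K"
      using uncountable_infinite[OF K] by (simp add: infinite_le_lepoll)
    show "\<not> (UNIV :: nat set) \<approx> K"
      using K countable_eqpoll[OF countableI_type eqpoll_sym] by blast
  qed
  finally show ?thesis .
next
  case False
  then have "generate G A \<lesssim> A"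
    using A(1) by (intro generate_lepoll_infinite) auto
  then show ?thesis
    using A(2) by (rule lesspoll_trans1)
qed

end

lemma under_card_of_lesspoll:
  assumes K: "infinite K" "A \<lesssim> K" and a: "a \<in> A"
  shows "under (card_of A) a \<prec> K"
proof -
  have "underS (card_of A) a \<prec> A"
    using card_of_underS[OF card_of_Card_order] a
    by (simp add: lesspoll_iff_card_of_ordLess Field_card_of)
  then have "insert a (underS (card_of A) a) \<prec> K"
    using K by (intro insert_lesspoll_infinite lesspoll_trans2[OF _ K(2)])
  moreover have "under (card_of A) a \<subseteq> insert a (underS (card_of A) a)"
    by (auto simp: under_def underS_def)
  then have "under (card_of A) a \<lesssim> insert a (underS (card_of A) a)"
    by (rule subset_imp_lepoll)
  ultimately show ?thesis
    by (rule lesspoll_trans1[rotated])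
qed

locale subgroup_chain = group G for G :: "('g, 'b) monoid_scheme" (structure) +
  fixes \<C> :: "'g set set"
  assumes chain: "chain\<^sub>\<subseteq> \<C>" and subgroups: "H \<in> \<C> \<Longrightarrow> subgroup H G"

lemma (in subgroup_chain) subgroup_Union:
  assumes "\<C> \<noteq> {}"
  shows "subgroup (\<Union>\<C>) G"
proof
  show "\<Union>\<C> \<subseteq> carrier G" "\<one> \<in> \<Union>\<C>"
    using assms subgroup.subset[OF subgroups] subgroup.one_closed[OF subgroups] by auto
  show "inv g \<in> \<Union>\<C>" if "g \<in> \<Union>\<C>" for g
    using that subgroup.m_inv_closed[OF subgroups] by blast
  show "g \<otimes> h \<in> \<Union>\<C>" if "g \<in> \<Union>\<C>" "h \<in> \<Union>\<C>" for g h
  proof -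
    obtain H where "H \<in> \<C>" "g \<in> H" "h \<in> H"
      using \<open>g \<in> \<Union>\<C>\<close> \<open>h \<in> \<Union>\<C>\<close> chain unfolding chain_subset_def by blast
    then show ?thesis
      using subgroup.m_closed[OF subgroups] by blast
  qed
qed

lemma (in group) ex_small_subgroup_chain:
  assumes K: "uncountable K" "carrier G \<lesssim> K"
  shows "\<exists>\<C>. subgroup_chain G \<C> \<and> \<Union>\<C> = carrier G \<and> (\<forall>H\<in>\<C>. H \<prec> K)"
proof -
  define r where "r = card_of (carrier G)"
  define H where "H a = generate G (under r a)" for a
  have "well_order_on (carrier G) r"
    unfolding r_def by (rule card_of_well_order_on)
  then have r: "r \<subseteq> carrier G \<times> carrier G" "trans r"
    "total_on (carrier G) r" "refl_on (carrier G) r"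
    by (auto simp: well_order_on_def linear_order_on_def partial_order_on_def preorder_on_def)
  have under_carrier: "under r a \<subseteq> carrier G" for a
    using r(1) by (auto simp: under_def)
  then have subgroup: "subgroup (H a) G" for a
    unfolding H_def by (rule generate_is_subgroup)
  have "H a \<subseteq> H b \<or> H b \<subseteq> H a" if "a \<in> carrier G" "b \<in> carrier G" for a b
  proof -
    have "(a, b) \<in> r \<or> (b, a) \<in> r"
      using r(3,4) that by (metis refl_onD total_on_def)
    then have "under r a \<subseteq> under r b \<or> under r b \<subseteq> under r a"
      using r(2) by (meson under_incr)
    then show ?thesis
      unfolding H_def using mono_generate by blast
  qed
  then have "chain\<^sub>\<subseteq> (H ` carrier G)"
    by (auto simp: chain_subset_def)
  then have "subgroup_chain G (H ` carrier G)"
    using subgroup by (intro subgroup_chain.intro subgroup_chain_axioms.intro group_axioms) auto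
  moreover have "H a \<prec> K" if "a \<in> carrier G" for a
    unfolding H_def using K that under_card_of_lesspoll[OF uncountable_infinite]
    by (intro generate_lesspoll_uncountable under_carrier) (auto simp: r_def)
  moreover have "a \<in> H a" if "a \<in> carrier G" for a
    unfolding H_def using that r(4) by (intro generate.incl) (auto simp: under_def refl_on_def)
  then have "\<Union>(H ` carrier G) = carrier G"
    using subgroup.subset[OF subgroup] by blast
  ultimately show ?thesis
    by blast
qed

section \<open>Extending partial actions\<close>

lemma (in group) group_actionI:
  assumes closed: "\<And>g x. g \<in> carrier G \<Longrightarrow> x \<in> X \<Longrightarrow> \<rho> g x \<in> X"
    and one: "\<And>x. x \<in> X \<Longrightarrow> \<rho> \<one> x = x"
    and mult: "\<And>g h x. g \<in> carrier G \<Longrightarrow> h \<in> carrier G \<Longrightarrow> x \<in> X \<Longrightarrow> \<rho> (g \<otimes> h) x = \<rho> g (\<rho> h x)"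
  shows "group_action G X (\<lambda>g. restrict (\<rho> g) X)"
proof -
  have "restrict (\<rho> g) X \<in> Bij X" if g: "g \<in> carrier G" for g
  proof -
    have "bij_betw (\<rho> g) X X"
      using g closed one mult[of g "inv g"] mult[of "inv g" g]
      by (intro bij_betwI[where g = "\<rho> (inv g)"]) (auto simp flip: mult)
    then show ?thesis
      by (simp add: Bij_def bij_betw_restrict_eq)
  qed
  moreover have "restrict (\<rho> (g \<otimes> h)) X = compose X (restrict (\<rho> g) X) (restrict (\<rho> h) X)"
    if "g \<in> carrier G" "h \<in> carrier G" for g h
    using that closed mult by (auto simp: compose_def restrict_def)
  ultimately have "(\<lambda>g. restrict (\<rho> g) X) \<in> hom G (BijGroup X)"
    by (auto simp: hom_def BijGroup_def)
  then show ?thesis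
    by (simp add: group_action_def group_hom_def group_hom_axioms_def group_BijGroup group_axioms)
qed

lemma (in group_action) transport_inj:
  assumes inj: "inj_on \<psi> E" and range: "\<psi> ` E \<subseteq> X"
  shows "\<exists>\<rho>. group_action G X \<rho> \<and> (\<forall>g\<in>carrier G. \<forall>w\<in>E. \<rho> g (\<psi> w) = \<psi> (\<phi> g w))"
proof -
  interpret group G
    using group_hom by (simp add: group_hom_def)
  define \<rho> where "\<rho> g x = (if x \<in> \<psi> ` E then \<psi> (\<phi> g (the_inv_into E \<psi> x)) else x)" for g x
  have on_range: "\<rho> g (\<psi> w) = \<psi> (\<phi> g w)" if "w \<in> E" for g w
    using that inj by (simp add: \<rho>_def the_inv_into_f_f)
  have off_range: "\<rho> g x = x" if "x \<notin> \<psi> ` E" for g x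
    using that by (simp add: \<rho>_def)
  have "group_action G X (\<lambda>g. restrict (\<rho> g) X)"
  proof (rule group_actionI)
    show "\<rho> g x \<in> X" if "g \<in> carrier G" "x \<in> X" for g x
      using that range element_image[of g] by (cases "x \<in> \<psi> ` E") (auto simp: on_range off_range)
    show "\<rho> \<one> x = x" for x
      using id_eq_one by (cases "x \<in> \<psi> ` E") (auto simp: on_range off_range simp flip: id_eq_one)
    show "\<rho> (g \<otimes> h) x = \<rho> g (\<rho> h x)" if "g \<in> carrier G" "h \<in> carrier G" for g h x
      using that element_image[of h]
      by (cases "x \<in> \<psi> ` E") (auto simp: on_range off_range composition_rule)
  qed
  then show ?thesis
    using range by (intro exI[of _ "\<lambda>g. restrict (\<rho> g) X"]) (auto simp: on_range image_subset_iff)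
qed

lemma extend_inverse_inj_on:
  assumes \<iota>: "inj_on \<iota> D" and D: "D \<subseteq> X" and W: "W \<lesssim> X - D"
  shows "\<exists>\<psi>. inj_on \<psi> W \<and> \<psi> ` W \<subseteq> X \<and> (\<forall>x\<in>D. \<psi> (\<iota> x) = x)"
proof -
  obtain f where f: "inj_on f W" "f ` W \<subseteq> X - D"
    using W by (auto simp: lepoll_def)
  define \<psi> where "\<psi> w = (if w \<in> \<iota> ` D then the_inv_into D \<iota> w else f w)" for w
  have inverse: "\<psi> (\<iota> x) = x" if "x \<in> D" for x
    using that \<iota> by (simp add: \<psi>_def the_inv_into_f_f)
  have outside: "\<psi> w = f w" if "w \<notin> \<iota> ` D" for w
    using that by (simp add: \<psi>_def)
  have D_iff: "\<psi> w \<in> D \<longleftrightarrow> w \<in> \<iota> ` D" and X_mem: "\<psi> w \<in> X" if "w \<in> W" for w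
    using that f(2) D inverse by (cases "w \<in> \<iota> ` D"; force simp: outside)+
  have "inj_on \<psi> W"
  proof (rule inj_onI)
    fix v w assume vw: "v \<in> W" "w \<in> W" "\<psi> v = \<psi> w"
    then consider "v \<in> \<iota> ` D" "w \<in> \<iota> ` D" | "v \<notin> \<iota> ` D" "w \<notin> \<iota> ` D"
      using D_iff by metis
    then show "v = w"
      using vw f(1) inverse outside by cases (auto dest: inj_onD)
  qed
  then show ?thesis
    using X_mem inverse by (intro exI[of _ \<psi>]) auto
qed

locale partial_group_action = group G for G :: "('g, 'b) monoid_scheme" (structure) +
  fixes D :: "'x set" and A :: "'x \<Rightarrow> 'g set" and \<eta> :: "'g \<Rightarrow> 'x \<Rightarrow> 'x"
  assumes subgroup_at: "x \<in> D \<Longrightarrow> subgroup (A x) G"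
    and orbit_closed: "x \<in> D \<Longrightarrow> g \<in> A x \<Longrightarrow> \<eta> g x \<in> D"
    and subgroup_orbit: "x \<in> D \<Longrightarrow> g \<in> A x \<Longrightarrow> A (\<eta> g x) = A x"
    and act_one: "x \<in> D \<Longrightarrow> \<eta> \<one> x = x"
    and act_mult: "x \<in> D \<Longrightarrow> g \<in> A x \<Longrightarrow> h \<in> A x \<Longrightarrow> \<eta> (g \<otimes> h) x = \<eta> g (\<eta> h x)"
begin

text \<open>The quotient by this relation is the disjoint union, over the orbits of the partial action, of
  the \<open>G\<close>-sets induced from them.\<close>

definition induced_rel :: "(('g \<times> 'x) \<times> ('g \<times> 'x)) set" where
  "induced_rel = {((g, x), (h, y)). g \<in> carrier G \<and> h \<in> carrier G \<and> x \<in> D \<and>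
     (\<exists>k\<in>A x. g = h \<otimes> k \<and> y = \<eta> k x)}"

definition induced_space :: "('g \<times> 'x) set set" where
  "induced_space = (carrier G \<times> D) // induced_rel"

definition induced_class :: "'g \<Rightarrow> 'x \<Rightarrow> ('g \<times> 'x) set" where
  "induced_class g x = induced_rel `` {(g, x)}"

definition induced_act :: "'g \<Rightarrow> ('g \<times> 'x) set \<Rightarrow> ('g \<times> 'x) set" where
  "induced_act h C = (\<lambda>(g, x). (h \<otimes> g, x)) ` C"

lemma subgroup_at_carrier: "x \<in> D \<Longrightarrow> g \<in> A x \<Longrightarrow> g \<in> carrier G"
  using subgroup_at by (rule subgroup.mem_carrier)

lemma sym_induced_rel: "sym induced_rel"
proof (rule symI, clarify)
  fix g x h y assume "((g, x), (h, y)) \<in> induced_rel"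
  then obtain k where k: "k \<in> A x" "g = h \<otimes> k" "y = \<eta> k x" and x: "x \<in> D"
    and gh: "g \<in> carrier G" "h \<in> carrier G"
    by (auto simp: induced_rel_def)
  have k_carrier: "k \<in> carrier G" and inv: "inv k \<in> A x"
    using subgroup_at_carrier[OF x k(1)] subgroup.m_inv_closed[OF subgroup_at[OF x] k(1)] .
  have "h = g \<otimes> inv k"
    using gh k_carrier k(2) by (simp add: m_assoc)
  moreover have "x = \<eta> (inv k) y"
    using k_carrier x k act_mult[OF x inv k(1)] by (simp add: act_one)
  moreover have "y \<in> D" "inv k \<in> A y"
    using x k inv by (auto simp: orbit_closed subgroup_orbit)
  ultimately show "((h, y), (g, x)) \<in> induced_rel"
    using gh unfolding induced_rel_def by blast
qed

lemma trans_induced_rel: "trans induced_rel"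
proof (rule transI, clarify)
  fix g x h y g' z assume "((g, x), (h, y)) \<in> induced_rel" "((h, y), (g', z)) \<in> induced_rel"
  then obtain k k' where k: "k \<in> A x" "g = h \<otimes> k" "y = \<eta> k x" "k' \<in> A y" "h = g' \<otimes> k'" "z = \<eta> k' y"
    and x: "x \<in> D" and g: "g \<in> carrier G" "g' \<in> carrier G"
    by (auto simp: induced_rel_def)
  have k': "k' \<in> A x"
    using k(1,3,4) subgroup_orbit[OF x] by simp
  then have "k' \<otimes> k \<in> A x"
    using k(1) subgroup.m_closed[OF subgroup_at[OF x]] by blast
  moreover have "g = g' \<otimes> (k' \<otimes> k)"
    using k g k' subgroup_at_carrier[OF x] by (simp add: m_assoc)
  moreover have "z = \<eta> (k' \<otimes> k) x"
    using k k' act_mult[OF x] by simp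
  ultimately show "((g, x), (g', z)) \<in> induced_rel"
    using g x unfolding induced_rel_def by blast
qed

lemma equiv_induced_rel: "equiv (carrier G \<times> D) induced_rel"
proof (rule equivI)
  show "induced_rel \<subseteq> (carrier G \<times> D) \<times> (carrier G \<times> D)"
    by (auto simp: induced_rel_def orbit_closed)
  show "refl_on (carrier G \<times> D) induced_rel"
    by (auto simp: refl_on_def induced_rel_def act_one subgroup.one_closed[OF subgroup_at]
        intro!: bexI[of _ \<one>])
qed (rule sym_induced_rel trans_induced_rel)+

lemma induced_class_eq_iff:
  assumes "g \<in> carrier G" "h \<in> carrier G" "x \<in> D" "y \<in> D"
  shows "induced_class g x = induced_class h y \<longleftrightarrow> (\<exists>k\<in>A x. g = h \<otimes> k \<and> y = \<eta> k x)"
proof -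
  have "induced_class g x = induced_class h y \<longleftrightarrow> ((g, x), (h, y)) \<in> induced_rel"
    unfolding induced_class_def using assms by (intro eq_equiv_class_iff[OF equiv_induced_rel]) auto
  then show ?thesis
    using assms by (auto simp: induced_rel_def)
qed

lemma induced_class_in_space: "g \<in> carrier G \<Longrightarrow> x \<in> D \<Longrightarrow> induced_class g x \<in> induced_space"
  by (auto simp: induced_class_def induced_space_def intro: quotientI)

lemma induced_space_cases:
  assumes "w \<in> induced_space"
  obtains g x where "g \<in> carrier G" "x \<in> D" "w = induced_class g x"
  using assms by (auto simp: induced_class_def induced_space_def elim!: quotientE)

lemma induced_act_class:
  assumes gh: "g \<in> carrier G" "h \<in> carrier G" and x: "x \<in> D"
  shows "induced_act h (induced_class g x) = induced_class (h \<otimes> g) x"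
proof -
  have class_eq: "induced_class g x = (\<lambda>k. (g \<otimes> inv k, \<eta> k x)) ` A x" if g: "g \<in> carrier G" for g
  proof -
    have "g = g' \<otimes> k \<longleftrightarrow> g' = g \<otimes> inv k" if "g' \<in> carrier G" "k \<in> A x" for g' k
      using that g subgroup_at_carrier[OF x] inv_solve_right by metis
    then show ?thesis
      using g x subgroup_at_carrier[OF x] unfolding induced_class_def induced_rel_def by auto
  qed
  show ?thesis
    unfolding induced_act_def class_eq[OF gh(1)] class_eq[OF m_closed[OF gh(2,1)]] image_image
    using gh subgroup_at_carrier[OF x] by (intro image_cong) (auto simp: m_assoc)
qed

lemma induced_group_action:
  "group_action G induced_space (\<lambda>g. restrict (induced_act g) induced_space)"
proof (rule group_actionI)
  show "induced_act g w \<in> induced_space" if "g \<in> carrier G" "w \<in> induced_space" for g w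
    using that by (auto elim!: induced_space_cases simp: induced_act_class induced_class_in_space)
  show "induced_act \<one> w = w" if "w \<in> induced_space" for w
    using that by (auto elim!: induced_space_cases simp: induced_act_class)
  show "induced_act (g \<otimes> h) w = induced_act g (induced_act h w)"
    if "g \<in> carrier G" "h \<in> carrier G" "w \<in> induced_space" for g h w
    using that by (auto elim!: induced_space_cases simp: induced_act_class m_assoc)
qed

lemma inj_on_induced_class_one: "inj_on (induced_class \<one>) D"
proof (rule inj_onI)
  fix x y assume xy: "x \<in> D" "y \<in> D" "induced_class \<one> x = induced_class \<one> y"
  then obtain k where "k \<in> A x" "\<one> = \<one> \<otimes> k" "y = \<eta> k x"
    by (auto simp: induced_class_eq_iff)
  moreover from this have "k = \<one>"
    using subgroup_at_carrier[OF xy(1)] by simp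
  ultimately show "x = y"
    using xy(1) by (simp add: act_one)
qed

lemma induced_class_orbit:
  assumes "x \<in> D" "g \<in> A x"
  shows "induced_class g x = induced_class \<one> (\<eta> g x)"
  using assms subgroup_at_carrier[OF assms]
  by (auto simp: induced_class_eq_iff orbit_closed intro!: bexI[of _ g])

theorem extend_to_group_action:
  assumes D: "D \<subseteq> X" and room: "carrier G \<times> D \<lesssim> X - D"
  shows "\<exists>\<rho>. group_action G X \<rho> \<and> (\<forall>x\<in>D. \<forall>g\<in>A x. \<rho> g x = \<eta> g x)"
proof -
  have "induced_space \<lesssim> carrier G \<times> D"
    unfolding induced_space_def quotient_def
    by (rule subset_image_lepoll[where f = "\<lambda>p. induced_rel `` {p}"]) auto
  also note room
  finally have "induced_space \<lesssim> X - D" .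
  then obtain \<psi> where \<psi>: "inj_on \<psi> induced_space" "\<psi> ` induced_space \<subseteq> X"
    and inverse: "\<forall>x\<in>D. \<psi> (induced_class \<one> x) = x"
    using extend_inverse_inj_on[OF inj_on_induced_class_one D] by blast
  obtain \<rho> where \<rho>: "group_action G X \<rho>"
    "\<forall>g\<in>carrier G. \<forall>w\<in>induced_space. \<rho> g (\<psi> w) = \<psi> (restrict (induced_act g) induced_space w)"
    using group_action.transport_inj[OF induced_group_action \<psi>] by blast
  have "\<rho> g x = \<eta> g x" if x: "x \<in> D" and g: "g \<in> A x" for x g
  proof -
    have g_carrier: "g \<in> carrier G"
      by (rule subgroup_at_carrier[OF x g])
    have "\<rho> g x = \<rho> g (\<psi> (induced_class \<one> x))"
      using x by (simp add: inverse)
    also have "\<dots> = \<psi> (induced_class g x)"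
      using x g_carrier by (simp add: \<rho>(2) induced_class_in_space induced_act_class)
    also have "\<dots> = \<eta> g x"
      using x g by (simp add: induced_class_orbit orbit_closed inverse)
    finally show ?thesis .
  qed
  then show ?thesis
    using \<rho>(1) by blast
qed

end

definition acts_at ::
  "('g, 'b) monoid_scheme \<Rightarrow> ('g \<Rightarrow> 'x \<Rightarrow> 'x) \<Rightarrow> 'x set \<Rightarrow> 'g set \<Rightarrow> 'x \<Rightarrow> bool" where
  "acts_at G \<eta> Y H x \<longleftrightarrow> (\<forall>g\<in>H. \<eta> g x \<in> Y) \<and> \<eta> \<one>\<^bsub>G\<^esub> x = x \<and>
     (\<forall>g\<in>H. \<forall>h\<in>H. \<eta> (g \<otimes>\<^bsub>G\<^esub> h) x = \<eta> g (\<eta> h x))"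

lemma (in group) acts_at_orbit:
  assumes H: "subgroup H G" and x: "acts_at G \<eta> Y H x" and k: "k \<in> H"
  shows "acts_at G \<eta> Y H (\<eta> k x)"
proof -
  interpret H: subgroup H G
    by (rule H)
  have mult: "\<eta> g (\<eta> h x) = \<eta> (g \<otimes> h) x" if "g \<in> H" "h \<in> H" for g h
    using that x by (simp add: acts_at_def)
  have in_Y: "\<eta> g x \<in> Y" if "g \<in> H" for g
    using that x by (simp add: acts_at_def)
  show ?thesis
    using k by (simp add: acts_at_def mult in_Y m_assoc)
qed

context subgroup_chain
begin

definition largest_acting :: "('g \<Rightarrow> 'x \<Rightarrow> 'x) \<Rightarrow> 'x set \<Rightarrow> 'x \<Rightarrow> 'g set" where
  "largest_acting \<eta> Y x = \<Union>{H\<in>\<C>. acts_at G \<eta> Y H x}"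

lemma acting_members:
  assumes "g \<in> largest_acting \<eta> Y x" "h \<in> largest_acting \<eta> Y x"
  obtains H where "H \<in> \<C>" "acts_at G \<eta> Y H x" "g \<in> H" "h \<in> H"
  using assms chain unfolding largest_acting_def chain_subset_def by blast

lemma largest_acting_orbit_supset:
  assumes "k \<in> largest_acting \<eta> Y x"
  shows "largest_acting \<eta> Y x \<subseteq> largest_acting \<eta> Y (\<eta> k x)"
proof
  fix g assume "g \<in> largest_acting \<eta> Y x"
  then obtain H where H: "H \<in> \<C>" "acts_at G \<eta> Y H x" "g \<in> H" "k \<in> H"
    using assms by (rule acting_members)
  then show "g \<in> largest_acting \<eta> Y (\<eta> k x)"
    using acts_at_orbit[OF subgroups[OF H(1)] H(2,4)] by (auto simp: largest_acting_def)
qed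

lemma partial_group_action_largest_acting:
  "partial_group_action G {x. \<exists>H\<in>\<C>. acts_at G \<eta> Y H x} (largest_acting \<eta> Y) \<eta>"
proof (intro partial_group_action.intro partial_group_action_axioms.intro group_axioms)
  fix x assume x: "x \<in> {x. \<exists>H\<in>\<C>. acts_at G \<eta> Y H x}"
  show subgroup: "subgroup (largest_acting \<eta> Y x) G"
    unfolding largest_acting_def using x chain subgroups
    by (intro subgroup_chain.subgroup_Union subgroup_chain.intro subgroup_chain_axioms.intro
          group_axioms)
       (auto simp: chain_subset_def)
  show one: "\<eta> \<one> x = x"
    using x by (auto simp: acts_at_def)
  show mult: "\<eta> (g \<otimes> h) x = \<eta> g (\<eta> h x)"
    if "g \<in> largest_acting \<eta> Y x" "h \<in> largest_acting \<eta> Y x" for g h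
    by (rule acting_members[OF that]) (auto simp: acts_at_def)
  fix k assume k: "k \<in> largest_acting \<eta> Y x"
  obtain H where H: "H \<in> \<C>" "acts_at G \<eta> Y H x" "k \<in> H"
    using k by (auto simp: largest_acting_def)
  show "\<eta> k x \<in> {x. \<exists>H\<in>\<C>. acts_at G \<eta> Y H x}"
    using acts_at_orbit[OF subgroups[OF H(1)] H(2,3)] H(1) by blast
  have inv: "inv k \<in> largest_acting \<eta> Y x"
    using subgroup k by (rule subgroup.m_inv_closed)
  have "\<eta> (inv k) (\<eta> k x) = x"
    using mult[OF inv k] one subgroup.mem_carrier[OF subgroup k] by simp
  then show "largest_acting \<eta> Y (\<eta> k x) = largest_acting \<eta> Y x"
    using largest_acting_orbit_supset[OF k] inv largest_acting_orbit_supset[of "inv k" \<eta> Y "\<eta> k x"]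
    by auto
qed

theorem group_action_extending_acts_at:
  assumes "Y \<subseteq> X" and room: "carrier G \<times> Y \<lesssim> X - Y"
  shows "\<exists>\<rho>. group_action G X \<rho> \<and>
    (\<forall>H\<in>\<C>. \<forall>g\<in>H. \<forall>x. acts_at G \<eta> Y H x \<longrightarrow> \<rho> g x = \<eta> g x)"
proof -
  define D where "D = {x. \<exists>H\<in>\<C>. acts_at G \<eta> Y H x}"
  interpret partial_group_action G D "largest_acting \<eta> Y" \<eta>
    unfolding D_def by (rule partial_group_action_largest_acting)
  have "D \<subseteq> Y"
    using subgroup.one_closed[OF subgroups] by (force simp: D_def acts_at_def)
  then have "carrier G \<times> D \<lesssim> carrier G \<times> Y"
    by (intro subset_imp_lepoll) auto
  also note room
  also have "X - Y \<lesssim> X - D"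
    using \<open>D \<subseteq> Y\<close> by (intro subset_imp_lepoll) auto
  finally have "carrier G \<times> D \<lesssim> X - D" .
  moreover have "D \<subseteq> X"
    using \<open>D \<subseteq> Y\<close> \<open>Y \<subseteq> X\<close> by simp
  ultimately obtain \<rho> where "group_action G X \<rho>"
    and \<rho>: "\<forall>x\<in>D. \<forall>g\<in>largest_acting \<eta> Y x. \<rho> g x = \<eta> g x"
    using extend_to_group_action by blast
  moreover have "\<rho> g x = \<eta> g x" if "H \<in> \<C>" "g \<in> H" "acts_at G \<eta> Y H x" for H g x
    using that \<rho> by (auto simp: D_def largest_acting_def)
  ultimately show ?thesis
    by blast
qed

end

section \<open>Finite Borel measures on metrizable spaces\<close>

lemma (in Metric_space) mball_basis_of_dense:
  assumes C: "C \<subseteq> M" "mtopology closure_of C = M" and U: "openin mtopology U" "x \<in> U"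
  obtains c n where "c \<in> C" "x \<in> mball c (inverse (Suc n))" "mball c (inverse (Suc n)) \<subseteq> U"
proof -
  obtain r where r: "r > 0" "mball x r \<subseteq> U"
    using U openin_mtopology by blast
  obtain n where n: "inverse (real (Suc n)) < r / 2"
    using reals_Archimedean[of "r / 2"] r by auto
  have x: "x \<in> M"
    using U openin_mtopology by blast
  then have "x \<in> mtopology closure_of C"
    using C by simp
  then obtain c where c: "c \<in> C" "c \<in> mball x (inverse (Suc n))"
    unfolding metric_closure_of using inverse_Suc[of n] by blast
  have "mball c (inverse (Suc n)) \<subseteq> mball x r"
  proof
    fix y assume y: "y \<in> mball c (inverse (Suc n))"
    then have "d x y \<le> d x c + d c y"
      using c x by (intro triangle) auto
    then show "y \<in> mball x r"
      using y c x n by auto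
  qed
  then show ?thesis
    using c x r(2) by (intro that[of c n]) (auto simp: commute)
qed

lemma separable_metrizable_imp_second_countable:
  assumes "metrizable_space X" "separable_space X"
  shows "second_countable X"
proof -
  obtain M d where "Metric_space M d" and X: "X = Metric_space.mtopology M d"
    using assms(1) metrizable_space_def by blast
  then interpret Metric_space M d
    by simp
  obtain C where C: "countable C" "C \<subseteq> M" "mtopology closure_of C = M"
    using assms(2) by (auto simp: separable_space_def X)
  define \<B> where "\<B> = (\<lambda>(c, n). mball c (inverse (real (Suc n)))) ` (C \<times> UNIV)"
  have "\<exists>V\<in>\<B>. x \<in> V \<and> V \<subseteq> U" if U: "openin mtopology U" "x \<in> U" for U x
  proof -
    obtain c n where "c \<in> C" "x \<in> mball c (inverse (Suc n))" "mball c (inverse (Suc n)) \<subseteq> U"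
      by (rule mball_basis_of_dense[OF C(2,3) U])
    then show ?thesis
      by (intro bexI[of _ "mball c (inverse (Suc n))"]) (auto simp: \<B>_def)
  qed
  moreover have "countable \<B>" "\<forall>V\<in>\<B>. openin mtopology V"
    using C(1) by (auto simp: \<B>_def)
  ultimately show ?thesis
    unfolding second_countable_def X by blast
qed

context finite_measure
begin

lemma decseq_empty_Inter_less:
  assumes "range A \<subseteq> sets M" "decseq A" "\<Inter>(range A) = {}" "0 < e"
  shows "\<exists>n. measure M (A n) < e"
proof -
  have "(\<lambda>n. measure M (A n)) \<longlonglongrightarrow> measure M (\<Inter>(range A))"
    using assms(1,2) by (rule finite_Lim_measure_decseq)
  then have "\<forall>\<^sub>F n in sequentially. measure M (A n) < e"
    using assms(3,4) by (intro order_tendstoD) auto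
  then show ?thesis
    using eventually_sequentially by auto
qed

lemma finite_subfamily_approx:
  assumes "countable S" "S \<subseteq> sets M" "0 < e"
  obtains F where "finite F" "F \<subseteq> S" "measure M (\<Union>S - \<Union>F) < e"
proof (cases "S = {}")
  case True
  then show ?thesis
    using assms that[of "{}"] by simp
next
  case False
  define A where "A n = \<Union>S - \<Union>(from_nat_into S ` {..<n})" for n
  have S: "range (from_nat_into S) = S"
    using False assms(1) by (rule range_from_nat_into)
  have "\<exists>n. measure M (A n) < e"
  proof (rule decseq_empty_Inter_less)
    have "\<Union>S \<in> sets M" "\<Union>(from_nat_into S ` {..<n}) \<in> sets M" for n
      using assms(1,2) from_nat_into[OF False]
      by (auto intro!: sets.finite_Union sets.countable_Union)
    then show "range A \<subseteq> sets M"
      by (auto simp: A_def)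
    show "decseq A"
      by (intro decseq_SucI) (auto simp: A_def)
    show "\<Inter>(range A) = {}"
      unfolding A_def by (subst (1) S[symmetric]) blast
  qed fact
  then obtain n where "measure M (A n) < e"
    by blast
  then show ?thesis
    using from_nat_into[OF False] by (intro that[of "from_nat_into S ` {..<n}"]) (auto simp: A_def)
qed

lemma measure_UN_le_geometric:
  assumes A: "range A \<subseteq> sets M" and le: "\<And>i::nat. measure M (A i) \<le> e * (1 / 2) ^ Suc i"
  shows "measure M (\<Union>i. A i) \<le> e"
proof -
  have sums: "(\<lambda>i. e * (1 / 2) ^ Suc i) sums e"
    using sums_mult[OF power_half_series, of e] by simp
  have summable: "summable (\<lambda>i. measure M (A i))"
    by (rule summable_comparison_test'[OF sums_summable[OF sums], of 0]) (use le in simp)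
  have "measure M (\<Union>i. A i) \<le> (\<Sum>i. measure M (A i))"
    using A summable by (rule finite_measure_subadditive_countably)
  also have "\<dots> \<le> (\<Sum>i. e * (1 / 2) ^ Suc i)"
    using le by (intro suminf_le summable sums_summable[OF sums])
  also have "\<dots> = e"
    using sums by (rule sums_unique[symmetric])
  finally show ?thesis .
qed

end

locale metrizable_borel_measure = finite_measure M for M :: "'x measure" +
  fixes T :: "'x topology"
  assumes metrizable: "metrizable_space T"
    and topspace [simp]: "topspace T = space M"
    and sets_eq: "sets M = sigma_sets (space M) {U. openin T U}"
begin

lemma openin_sets: "openin T U \<Longrightarrow> U \<in> sets M"
  by (auto simp: sets_eq)

lemma closedin_sets: "closedin T C \<Longrightarrow> C \<in> sets M"
  using sets.compl_sets[OF openin_sets, of "space M - C"] by (auto simp: closedin_def double_diff)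

lemma closedin_singleton: "x \<in> space M \<Longrightarrow> closedin T {x}"
  using metrizable_imp_t1_space[OF metrizable] by (simp add: t1_space_closedin_singleton)

definition regular_set :: "'x set \<Rightarrow> bool" where
  "regular_set B \<longleftrightarrow>
     (\<forall>e>0. \<exists>C U. closedin T C \<and> openin T U \<and> C \<subseteq> B \<and> B \<subseteq> U \<and> measure M (U - C) < e)"

lemma regular_set_open:
  assumes U: "openin T U"
  shows "regular_set U"
  unfolding regular_set_def
proof (intro allI impI)
  fix e :: real assume e: "0 < e"
  obtain C where C: "\<And>n. closedin T (C n)" "\<And>n. C n \<subseteq> C (Suc n)" "\<Union>(range C) = U"
    using open_imp_fsigma_in[OF metrizable U] unfolding fsigma_in_ascending by blast
  have "\<exists>n. measure M (U - C n) < e"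
    using e C U
    by (intro decseq_empty_Inter_less decseq_SucI) (auto intro: openin_sets closedin_sets)
  then show "\<exists>C V. closedin T C \<and> openin T V \<and> C \<subseteq> U \<and> U \<subseteq> V \<and> measure M (V - C) < e"
    using C(1,3) U by blast
qed

lemma regular_set_Compl:
  assumes "regular_set B"
  shows "regular_set (space M - B)"
  unfolding regular_set_def
proof (intro allI impI)
  fix e :: real assume "0 < e"
  then obtain C U where CU: "closedin T C" "openin T U" "C \<subseteq> B" "B \<subseteq> U" "measure M (U - C) < e"
    using assms by (auto simp: regular_set_def)
  then have "closedin T (space M - U)" "openin T (space M - C)"
    using openin_closedin_eq[of T U] by (auto simp: closedin_def double_diff)
  moreover have "(space M - C) - (space M - U) = U - C"
    using openin_subset[OF CU(2)] by auto
  ultimately show "\<exists>C U. closedin T C \<and> openin T U \<and> C \<subseteq> space M - B \<and> space M - B \<subseteq> U \<and>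
    measure M (U - C) < e"
    using CU by (intro exI[of _ "space M - U"] exI[of _ "space M - C"]) auto
qed

lemma regular_set_UN:
  fixes B :: "nat \<Rightarrow> 'x set"
  assumes "\<And>i. regular_set (B i)"
  shows "regular_set (\<Union>i. B i)"
  unfolding regular_set_def
proof (intro allI impI)
  fix e :: real assume e: "0 < e"
  have "\<exists>C U. closedin T C \<and> openin T U \<and> C \<subseteq> B i \<and> B i \<subseteq> U \<and>
    measure M (U - C) < e / 2 * (1 / 2) ^ Suc i" for i
    by (rule assms[of i, unfolded regular_set_def, rule_format]) (use e in simp)
  then obtain C U where C: "\<And>i. closedin T (C i)" "\<And>i. C i \<subseteq> B i"
    and U: "\<And>i. openin T (U i)" "\<And>i. B i \<subseteq> U i"
    and less: "\<And>i. measure M (U i - C i) < e / 2 * (1 / 2) ^ Suc i"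
    by metis
  obtain F where F: "finite F" "F \<subseteq> range C" "measure M (\<Union>(range C) - \<Union>F) < e / 2"
    by (rule finite_subfamily_approx[of "range C" "e / 2"])
       (use e C(1) in \<open>auto intro: closedin_sets\<close>)
  have open_U: "openin T (\<Union>(range U))" and closed_F: "closedin T (\<Union>F)"
    using U(1) C(1) F(1,2) by (auto intro!: closedin_Union)
  have diff: "range (\<lambda>i. U i - C i) \<subseteq> sets M" "\<Union>(range C) - \<Union>F \<in> sets M"
    using U(1) C(1) closed_F
    by (auto intro!: sets.Diff sets.countable_UN intro: openin_sets closedin_sets)
  have "\<Union>(range U) - \<Union>F \<subseteq> (\<Union>i. U i - C i) \<union> (\<Union>(range C) - \<Union>F)"
    by blast
  then have "measure M (\<Union>(range U) - \<Union>F) \<le> measure M ((\<Union>i. U i - C i) \<union> (\<Union>(range C) - \<Union>F))"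
    using diff by (intro finite_measure_mono) auto
  also have "\<dots> \<le> measure M (\<Union>i. U i - C i) + measure M (\<Union>(range C) - \<Union>F)"
    using diff by (intro measure_Un_le) auto
  also have "\<dots> < e"
    using measure_UN_le_geometric[OF diff(1), of "e / 2"] less F(3) by (force intro: less_imp_le)
  finally have "measure M (\<Union>(range U) - \<Union>F) < e" .
  moreover have "\<Union>F \<subseteq> (\<Union>i. B i)"
    using Union_mono[OF F(2)] UN_mono[OF subset_refl C(2)] by (rule order_trans)
  moreover have "(\<Union>i. B i) \<subseteq> \<Union>(range U)"
    using U(2) by (rule UN_mono[OF subset_refl])
  ultimately show "\<exists>C U. closedin T C \<and> openin T U \<and> C \<subseteq> (\<Union>i. B i) \<and> (\<Union>i. B i) \<subseteq> U \<and>
    measure M (U - C) < e"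
    using open_U closed_F by (intro exI[of _ "\<Union>F"] exI[of _ "\<Union>(range U)"] conjI)
qed

lemma regular_set_sets:
  assumes "B \<in> sets M"
  shows "regular_set B"
  using assms unfolding sets_eq
proof (induction rule: sigma_sets.induct)
  case Empty
  show ?case
    by (intro regular_set_open) simp
qed (auto intro: regular_set_open regular_set_Compl regular_set_UN)

lemma outer_regular:
  assumes B: "B \<in> sets M" and e: "0 < e"
  obtains U where "openin T U" "B \<subseteq> U" "measure M (U - B) < e"
proof -
  obtain C U where CU: "closedin T C" "openin T U" "C \<subseteq> B" "B \<subseteq> U" "measure M (U - C) < e"
    using regular_set_sets[OF B] e by (auto simp: regular_set_def)
  then have "measure M (U - B) \<le> measure M (U - C)"
    using B by (intro finite_measure_mono) (auto intro: openin_sets closedin_sets)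
  then show ?thesis
    using CU that by force
qed

lemma null_sets_completion_iff_open_covers:
  "N \<in> null_sets (completion M) \<longleftrightarrow> (\<forall>e>0. \<exists>U. openin T U \<and> N \<subseteq> U \<and> measure M U < e)"
proof (intro iffI allI impI)
  fix e :: real assume N: "N \<in> null_sets (completion M)" and e: "0 < e"
  obtain N' where N': "N' \<in> null_sets M" "N \<subseteq> N'"
    using N by (auto simp: null_sets_completion_iff2)
  then obtain U where U: "openin T U" "N' \<subseteq> U" "measure M (U - N') < e"
    using outer_regular[OF _ e] by blast
  then have "measure M U < e"
    using N'(1) by (simp add: measure_Diff_null_set openin_sets)
  then show "\<exists>U. openin T U \<and> N \<subseteq> U \<and> measure M U < e"
    using U N'(2) by blast
next
  assume covers: "\<forall>e>0. \<exists>U. openin T U \<and> N \<subseteq> U \<and> measure M U < e"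
  show "N \<in> null_sets (completion M)"
    unfolding completion.null_sets_outer
  proof (intro allI impI)
    fix e :: real assume "0 < e"
    then obtain U where "openin T U" "N \<subseteq> U" "measure M U < e"
      using covers by blast
    then show "\<exists>U\<in>fmeasurable (completion M). N \<subseteq> U \<and> measure (completion M) U < e"
      by (intro bexI[of _ U]) (auto simp: openin_sets less_top[symmetric] intro!: fmeasurableI)
  qed
qed

lemma gdelta_hull:
  assumes B: "B \<in> sets M"
  obtains S where "gdelta_in T S" "B \<subseteq> S" "S - B \<in> null_sets M"
proof -
  have "\<exists>U. openin T U \<and> B \<subseteq> U \<and> measure M (U - B) < inverse (Suc n)" for n
    by (rule outer_regular[OF B, of "inverse (Suc n)"]) auto
  then obtain U where U: "\<And>n. openin T (U n)" "\<And>n. B \<subseteq> U n"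
    and less: "\<And>n. measure M (U n - B) < inverse (Suc n)"
    by metis
  define S where "S = (\<Inter>n. U n)"
  have S: "S \<in> sets M"
    unfolding S_def using U(1) by (intro sets.countable_INT) (auto intro: openin_sets)
  have "measure M (S - B) < e" if "0 < e" for e
  proof -
    obtain n where "inverse (Suc n) < e"
      using reals_Archimedean[OF \<open>0 < e\<close>] by blast
    moreover have "measure M (S - B) \<le> measure M (U n - B)"
      using B U(1) by (intro finite_measure_mono) (auto simp: S_def intro: openin_sets)
    ultimately show ?thesis
      using less[of n] by simp
  qed
  then have "measure M (S - B) = 0"
    by (metis less_irrefl measure_nonneg order_le_less)
  then have "S - B \<in> null_sets M"
    using S B by (simp add: null_sets_def emeasure_eq_measure sets.Diff)
  moreover have "gdelta_in T S"
    unfolding S_def using U(1) by (intro gdelta_in_Inter) (auto intro: open_imp_gdelta_in)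
  ultimately show ?thesis
    using U(2) by (intro that[of S]) (auto simp: S_def)
qed

end

locale second_countable_borel_measure = metrizable_borel_measure M T
  for M :: "'x measure" and T +
  assumes second_countable: "second_countable T"
begin

definition base :: "'x set set" where
  "base = (SOME \<B>. countable \<B> \<and> (\<forall>B\<in>\<B>. openin T B) \<and>
     (\<forall>U x. openin T U \<and> x \<in> U \<longrightarrow> (\<exists>B\<in>\<B>. x \<in> B \<and> B \<subseteq> U)))"

lemma countable_base: "countable base"
  and openin_base: "B \<in> base \<Longrightarrow> openin T B"
  and base_neighbourhood: "openin T U \<Longrightarrow> x \<in> U \<Longrightarrow> \<exists>B\<in>base. x \<in> B \<and> B \<subseteq> U"
  using someI_ex[OF second_countable[unfolded second_countable_def], folded base_def] by blast+

lemma open_eq_Union_base: "openin T U \<Longrightarrow> U = \<Union>{B\<in>base. B \<subseteq> U}"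
  using base_neighbourhood by blast

lemma open_family_countable_subfamily:
  assumes "\<And>U. U \<in> \<U> \<Longrightarrow> openin T U"
  obtains \<V> where "countable \<V>" "\<V> \<subseteq> \<U>" "\<Union>\<V> = \<Union>\<U>"
proof -
  define \<B> where "\<B> = {B\<in>base. \<exists>U\<in>\<U>. B \<subseteq> U}"
  have "\<forall>B\<in>\<B>. \<exists>U. U \<in> \<U> \<and> B \<subseteq> U"
    by (auto simp: \<B>_def)
  then obtain f where f: "\<forall>B\<in>\<B>. f B \<in> \<U> \<and> B \<subseteq> f B"
    by (rule bchoice[THEN exE])
  have "\<Union>\<U> \<subseteq> \<Union>\<B>"
  proof
    fix x assume "x \<in> \<Union>\<U>"
    then obtain U where U: "U \<in> \<U>" "x \<in> U"
      by blast
    then obtain B where "B \<in> base" "x \<in> B" "B \<subseteq> U"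
      using base_neighbourhood[OF assms] by blast
    with U(1) show "x \<in> \<Union>\<B>"
      by (auto simp: \<B>_def)
  qed
  then have "\<Union>(f ` \<B>) = \<Union>\<U>"
    using f by blast
  moreover have "countable (f ` \<B>)"
    using countable_base by (auto simp: \<B>_def)
  ultimately show ?thesis
    using f by (intro that[of "f ` \<B>"]) auto
qed

lemma open_family_finite_approx:
  assumes \<U>: "\<And>U. U \<in> \<U> \<Longrightarrow> openin T U" and e: "0 < e"
  obtains F where "finite F" "F \<subseteq> \<U>" "measure M (\<Union>\<U> - \<Union>F) < e"
proof -
  obtain \<V> where \<V>: "countable \<V>" "\<V> \<subseteq> \<U>" "\<Union>\<V> = \<Union>\<U>"
    by (rule open_family_countable_subfamily[OF \<U>])
  have "\<V> \<subseteq> sets M"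
    using \<V>(2) \<U> openin_sets by blast
  then obtain F where "finite F" "F \<subseteq> \<V>" "measure M (\<Union>\<V> - \<Union>F) < e"
    using \<V>(1) e by (elim finite_subfamily_approx[rotated])
  then show ?thesis
    using \<V> that by auto
qed

end

section \<open>Martin's Axiom and null sets\<close>

definition null_additive_below_continuum :: "'a measure \<Rightarrow> bool" where
  "null_additive_below_continuum M \<longleftrightarrow>
     (\<forall>\<N>. \<N> \<prec> (UNIV :: real set) \<and> \<N> \<subseteq> null_sets (completion M) \<longrightarrow> \<Union>\<N> \<in> null_sets (completion M))"

lemma AE_ball_below_continuum:
  assumes M: "null_additive_below_continuum M" and I: "I \<prec> (UNIV :: real set)"
    and P: "\<And>i. i \<in> I \<Longrightarrow> AE x in M. P i x"
  shows "AE x in M. \<forall>i\<in>I. P i x"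
proof -
  define N where "N i = {x\<in>space M. \<not> P i x}" for i
  have "N ` I \<prec> (UNIV :: real set)"
    using image_lepoll I by (rule lesspoll_trans1)
  moreover have "N ` I \<subseteq> null_sets (completion M)"
    using AE_completion[OF P] completion.AE_iff_null_sets by (auto simp: N_def)
  ultimately have "\<Union>(N ` I) \<in> null_sets (completion M)"
    using M by (simp add: null_additive_below_continuum_def)
  also have "\<Union>(N ` I) = {x\<in>space M. \<not> (\<forall>i\<in>I. P i x)}"
    by (auto simp: N_def)
  finally have "AE x in completion M. \<forall>i\<in>I. P i x"
    by (simp add: completion.AE_iff_null_sets)
  then show ?thesis
    by (simp only: AE_completion_iff)
qed

lemma martins_axiom_filter:
  assumes MA: "martins_axiom TYPE(real)" and P: "P \<noteq> {}" "ccc_poset P r"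
    and I: "I \<prec> (UNIV :: real set)" and D: "\<And>i. i \<in> I \<Longrightarrow> dense_in_poset P r (D i)"
  shows "\<exists>F. poset_filter P r F \<and> (\<forall>i\<in>I. F \<inter> D i \<noteq> {})"
proof -
  have "D ` I \<prec> (UNIV :: real set)"
    using image_lepoll I by (rule lesspoll_trans1)
  moreover have "\<forall>X\<in>D ` I. dense_in_poset P r X"
    using D by blast
  ultimately have "\<exists>F. poset_filter P r F \<and> (\<forall>X\<in>D ` I. F \<inter> X \<noteq> {})"
    using martins_axiom_any_type[OF MA] P unfolding martins_axiom_def by meson
  then show ?thesis
    by simp
qed

definition reverse_inclusion :: "'a set set \<Rightarrow> 'a set rel" where
  "reverse_inclusion P = {(U, V) \<in> P \<times> P. V \<subseteq> U}"

lemma partial_order_on_reverse_inclusion: "partial_order_on P (reverse_inclusion P)"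
  by (auto simp: reverse_inclusion_def partial_order_on_def preorder_on_def
      refl_on_def trans_def antisym_def)

lemma reverse_inclusion_filter_Union:
  assumes F: "poset_filter P (reverse_inclusion P) F" and "finite S" "S \<subseteq> F"
  shows "\<exists>U\<in>F. \<Union>S \<subseteq> U"
  using assms(2,3)
proof (induction S rule: finite_induct)
  case empty
  then show ?case
    using F by (auto simp: poset_filter_def)
next
  case (insert V S)
  then obtain U where U: "U \<in> F" "\<Union>S \<subseteq> U" and V: "V \<in> F"
    by auto
  then obtain W where W: "W \<in> F" "(W, U) \<in> reverse_inclusion P" "(W, V) \<in> reverse_inclusion P"
    using F unfolding poset_filter_def by blast
  then have "\<Union>(insert V S) \<subseteq> W"
    using U(2) by (auto simp: reverse_inclusion_def)
  with W(1) show ?case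
    by blast
qed

context second_countable_borel_measure
begin

definition amoeba :: "real \<Rightarrow> 'x set set" where
  "amoeba e = {U. openin T U \<and> measure M U < e}"

lemma amoeba_compatible:
  assumes U: "U \<in> amoeba e" "measure M (U - C) < e - measure M U"
    and V: "V \<in> amoeba e" "measure M (V - C) < e - measure M V"
    and C: "C \<in> sets M" "C \<subseteq> U" "C \<subseteq> V"
  shows "compatible (amoeba e) (reverse_inclusion (amoeba e)) U V"
proof -
  have less: "measure M (A \<union> B) < e" if "openin T A" "openin T B" "C \<subseteq> A"
    "measure M A \<le> measure M B" "measure M (B - C) < e - measure M B" for A B
  proof -
    have "measure M (A \<union> B) = measure M (A \<union> (B - C))"
      using \<open>C \<subseteq> A\<close> by (intro arg_cong[of _ _ "measure M"]) auto
    also have "\<dots> \<le> measure M A + measure M (B - C)"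
      using that C(1) by (intro measure_Un_le) (auto intro: openin_sets)
    finally show ?thesis
      using that by linarith
  qed
  have UV: "openin T U" "openin T V"
    using U(1) V(1) by (auto simp: amoeba_def)
  then have "measure M (U \<union> V) < e"
    using less[of U V] less[of V U] U(2) V(2) C(2,3)
    by (cases "measure M U \<le> measure M V") (auto simp: Un_commute)
  then have "U \<union> V \<in> amoeba e"
    using UV by (auto simp: amoeba_def)
  then show ?thesis
    using U(1) V(1) by (auto simp: compatible_def reverse_inclusion_def)
qed

text \<open>Assigning to each condition a finite subset of the base which exhausts it up to its slack
  \<open>e - measure M U\<close> is injective on antichains.\<close>

lemma ccc_amoeba: "ccc_poset (amoeba e) (reverse_inclusion (amoeba e))"
  unfolding ccc_poset_def
proof (intro conjI allI impI partial_order_on_reverse_inclusion)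
  fix A assume A: "A \<subseteq> amoeba e"
    "\<forall>U\<in>A. \<forall>V\<in>A. U \<noteq> V \<longrightarrow> \<not> compatible (amoeba e) (reverse_inclusion (amoeba e)) U V"
  have "\<exists>F. finite F \<and> F \<subseteq> base \<and> \<Union>F \<subseteq> U \<and> measure M (U - \<Union>F) < e - measure M U" if "U \<in> A" for U
  proof -
    have U: "openin T U" "0 < e - measure M U"
      using A(1) \<open>U \<in> A\<close> by (auto simp: amoeba_def)
    obtain F where "finite F" "F \<subseteq> {B\<in>base. B \<subseteq> U}"
      "measure M (\<Union>{B\<in>base. B \<subseteq> U} - \<Union>F) < e - measure M U"
      by (rule open_family_finite_approx[OF _ U(2), of "{B\<in>base. B \<subseteq> U}"]) (auto intro: openin_base)
    then show ?thesis
      unfolding open_eq_Union_base[OF U(1), symmetric] by blast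
  qed
  then obtain F where F: "\<And>U. U \<in> A \<Longrightarrow> finite (F U) \<and> F U \<subseteq> base \<and> \<Union>(F U) \<subseteq> U \<and>
    measure M (U - \<Union>(F U)) < e - measure M U"
    by metis
  have "inj_on F A"
  proof (rule inj_onI, rule ccontr)
    fix U V assume UV: "U \<in> A" "V \<in> A" "F U = F V" "U \<noteq> V"
    have "\<Union>(F U) \<in> sets M"
      using F[OF UV(1)] by (intro sets.finite_Union) (auto intro: openin_sets openin_base)
    then have "compatible (amoeba e) (reverse_inclusion (amoeba e)) U V"
      using F[OF UV(1)] F[OF UV(2)] UV A(1) by (intro amoeba_compatible[of U e "\<Union>(F U)" V]) auto
    then show False
      using A(2) UV by blast
  qed
  moreover have "countable (F ` A)"
    using F
    by (intro countable_subset[OF _ countable_Collect_finite_subset[OF countable_base]]) auto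
  ultimately show "countable A"
    using countable_image_inj_on by blast
qed

lemma dense_amoeba_covering:
  assumes N: "N \<in> null_sets (completion M)"
  shows "dense_in_poset (amoeba e) (reverse_inclusion (amoeba e)) {U\<in>amoeba e. N \<subseteq> U}"
  unfolding dense_in_poset_def
proof (intro conjI ballI)
  fix U assume U: "U \<in> amoeba e"
  then have "0 < e - measure M U"
    by (simp add: amoeba_def)
  then obtain V where V: "openin T V" "N \<subseteq> V" "measure M V < e - measure M U"
    using N unfolding null_sets_completion_iff_open_covers by blast
  have "measure M (U \<union> V) \<le> measure M U + measure M V"
    using U V by (intro measure_Un_le) (auto simp: amoeba_def intro: openin_sets)
  then have "U \<union> V \<in> amoeba e"
    using U V by (auto simp: amoeba_def)
  then show "\<exists>W\<in>{U\<in>amoeba e. N \<subseteq> U}. (W, U) \<in> reverse_inclusion (amoeba e)"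
    using U V(2) by (intro bexI[of _ "U \<union> V"]) (auto simp: reverse_inclusion_def)
qed auto

lemma measure_amoeba_filter_Union_le:
  assumes F: "poset_filter (amoeba e) (reverse_inclusion (amoeba e)) F"
  shows "measure M (\<Union>F) \<le> e"
proof (rule field_le_epsilon)
  fix d :: real assume d: "0 < d"
  have F_amoeba: "F \<subseteq> amoeba e"
    using F by (simp add: poset_filter_def)
  then have opens: "openin T U" if "U \<in> F" for U
    using that by (auto simp: amoeba_def)
  obtain S where S: "finite S" "S \<subseteq> F" "measure M (\<Union>F - \<Union>S) < d"
    using open_family_finite_approx[of F d] opens d by blast
  obtain U where U: "U \<in> F" "\<Union>S \<subseteq> U"
    using reverse_inclusion_filter_Union[OF F S(1,2)] by blast
  have "openin T (\<Union>F)" "openin T (\<Union>S)"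
    using opens S(2) by auto
  then have "measure M (\<Union>F) \<le> measure M (U \<union> (\<Union>F - \<Union>S))"
    using U opens by (intro finite_measure_mono sets.Un sets.Diff openin_sets) auto
  also have "\<dots> \<le> measure M U + measure M (\<Union>F - \<Union>S)"
    using \<open>openin T (\<Union>F)\<close> \<open>openin T (\<Union>S)\<close> opens U(1)
    by (intro measure_Un_le sets.Diff openin_sets)
  also have "\<dots> \<le> e + d"
    using U(1) F_amoeba S(3) by (auto simp: amoeba_def)
  finally show "measure M (\<Union>F) \<le> e + d" .
qed

theorem martins_axiom_imp_null_additive:
  assumes MA: "martins_axiom TYPE(real)"
  shows "null_additive_below_continuum M"
  unfolding null_additive_below_continuum_def
proof (intro allI impI, elim conjE)
  fix \<N> assume small: "\<N> \<prec> (UNIV :: real set)" and null: "\<N> \<subseteq> null_sets (completion M)"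
  show "\<Union>\<N> \<in> null_sets (completion M)"
    unfolding null_sets_completion_iff_open_covers
  proof (intro allI impI)
    fix e :: real assume e: "0 < e"
    have "{} \<in> amoeba (e / 2)"
      using e by (simp add: amoeba_def)
    then obtain F where F: "poset_filter (amoeba (e / 2)) (reverse_inclusion (amoeba (e / 2))) F"
      and meets: "\<forall>N\<in>\<N>. F \<inter> {U\<in>amoeba (e / 2). N \<subseteq> U} \<noteq> {}"
      using martins_axiom_filter[OF MA _ ccc_amoeba small, of "e / 2"
          "\<lambda>N. {U\<in>amoeba (e / 2). N \<subseteq> U}"] dense_amoeba_covering null by blast
    have "F \<subseteq> amoeba (e / 2)"
      using F by (simp add: poset_filter_def)
    then have "openin T (\<Union>F)"
      by (auto simp: amoeba_def)
    moreover have "\<Union>\<N> \<subseteq> \<Union>F"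
      using meets by blast
    moreover have "measure M (\<Union>F) < e"
      using measure_amoeba_filter_Union_le[OF F] e by linarith
    ultimately show "\<exists>U. openin T U \<and> \<Union>\<N> \<subseteq> U \<and> measure M U < e"
      by blast
  qed
qed

end

section \<open>The continuum in a Polish probability space\<close>

lemma Pow_countable_lepoll_continuum:
  assumes "countable A"
  shows "Pow A \<lesssim> (UNIV :: real set)"
proof -
  have "inj_on ((`) (to_nat_on A)) (Pow A)"
    using inj_on_to_nat_on[OF assms] by (intro inj_on_image) simp
  then have "Pow A \<lesssim> (UNIV :: nat set set)"
    by (auto simp: lepoll_def)
  also note nat_sets_eqpoll_reals
  finally show ?thesis .
qed

context second_countable_borel_measure
begin

lemma base_separates_points:
  assumes "x \<in> space M" "y \<in> space M" "\<forall>B\<in>base. x \<in> B \<longleftrightarrow> y \<in> B"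
  shows "x = y"
proof (rule ccontr)
  assume "x \<noteq> y"
  then obtain U where "openin T U" "x \<in> U" "y \<notin> U"
    using metrizable_imp_t1_space[OF metrizable] assms(1,2) unfolding t1_space_def topspace by meson
  then show False
    using base_neighbourhood assms(3) by blast
qed

lemma space_lepoll_continuum: "space M \<lesssim> (UNIV :: real set)"
proof -
  have "inj_on (\<lambda>x. {B\<in>base. x \<in> B}) (space M)"
    by (intro inj_onI base_separates_points) auto
  then have "space M \<lesssim> Pow base"
    unfolding lepoll_def by (intro exI[of _ "\<lambda>x. {B\<in>base. x \<in> B}"]) auto
  also have "Pow base \<lesssim> (UNIV :: real set)"
    by (rule Pow_countable_lepoll_continuum[OF countable_base])
  finally show ?thesis .
qed

lemma measure_algebra_code:
  obtains code :: "'x set \<Rightarrow> (nat \<times> 'x set) set" where "\<And>Q. code Q \<subseteq> UNIV \<times> base"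
    "\<And>Q R. Q \<in> sets M \<Longrightarrow> R \<in> sets M \<Longrightarrow> code Q = code R \<Longrightarrow> AE x in M. x \<in> Q \<longleftrightarrow> x \<in> R"
proof -
  have "\<exists>U. (\<forall>n::nat. openin T (U n)) \<and> (AE x in M. x \<in> Q \<longleftrightarrow> x \<in> (\<Inter>n. U n))" if Q: "Q \<in> sets M" for Q
  proof -
    obtain S where S: "gdelta_in T S" "Q \<subseteq> S" "S - Q \<in> null_sets M"
      by (rule gdelta_hull[OF Q])
    obtain U where U: "\<forall>n::nat. openin T (U n)" "\<Inter>(range U) = S"
      using S(1) unfolding gdelta_in_descending by blast
    have "AE x in M. x \<in> Q \<longleftrightarrow> x \<in> S"
      using AE_not_in[OF S(3)] by eventually_elim (use S(2) in blast)
    then show ?thesis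
      using U by blast
  qed
  then obtain U where U: "\<And>Q n. Q \<in> sets M \<Longrightarrow> openin T (U Q n)"
    "\<And>Q. Q \<in> sets M \<Longrightarrow> AE x in M. x \<in> Q \<longleftrightarrow> x \<in> (\<Inter>n::nat. U Q n)"
    by metis
  define code where "code Q = {(n, B). B \<in> base \<and> B \<subseteq> U Q n}" for Q
  have "AE x in M. x \<in> Q \<longleftrightarrow> x \<in> R" if QR: "Q \<in> sets M" "R \<in> sets M" "code Q = code R" for Q R
  proof -
    have "{B\<in>base. B \<subseteq> U Q n} = {B\<in>base. B \<subseteq> U R n}" for n
      using QR(3) by (auto simp: code_def set_eq_iff)
    then have eq: "U Q n = U R n" for n
      using open_eq_Union_base[OF U(1)[OF QR(1)]] open_eq_Union_base[OF U(1)[OF QR(2)]] by metis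
    show ?thesis
      using U(2)[OF QR(1)] U(2)[OF QR(2)] by eventually_elim (simp add: eq)
  qed
  then show ?thesis
    using that[of code] by (auto simp: code_def)
qed

lemma AE_eq_if_AE_base_iff:
  assumes maps: "f \<in> space M \<rightarrow> space M" "g \<in> space M \<rightarrow> space M"
    and iff: "\<And>B. B \<in> base \<Longrightarrow> AE x in M. f x \<in> B \<longleftrightarrow> g x \<in> B"
  shows "AE x in M. f x = g x"
proof -
  have "AE x in M. \<forall>B\<in>base. f x \<in> B \<longleftrightarrow> g x \<in> B"
    using countable_base iff by (simp add: AE_ball_countable)
  then show ?thesis
    using AE_space by eventually_elim (use maps in \<open>blast intro: base_separates_points\<close>)
qed

lemma AE_distinct_maps_lepoll_continuum:
  fixes f :: "'i \<Rightarrow> 'x \<Rightarrow> 'x"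
  assumes f: "\<And>i. i \<in> I \<Longrightarrow> f i \<in> space M \<rightarrow> space M"
    and vimage: "\<And>i B. i \<in> I \<Longrightarrow> openin T B \<Longrightarrow> \<exists>Q\<in>sets M. AE x in M. f i x \<in> B \<longleftrightarrow> x \<in> Q"
    and distinct: "\<And>i j. i \<in> I \<Longrightarrow> j \<in> I \<Longrightarrow> AE x in M. f i x = f j x \<Longrightarrow> i = j"
  shows "I \<lesssim> (UNIV :: real set)"
proof -
  obtain code :: "'x set \<Rightarrow> (nat \<times> 'x set) set" where range: "\<And>Q. code Q \<subseteq> UNIV \<times> base"
    and code: "\<And>Q R. Q \<in> sets M \<Longrightarrow> R \<in> sets M \<Longrightarrow> code Q = code R \<Longrightarrow> AE x in M. x \<in> Q \<longleftrightarrow> x \<in> R"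
    using measure_algebra_code by blast
  obtain Q where Q: "\<And>i B. i \<in> I \<Longrightarrow> B \<in> base \<Longrightarrow> Q i B \<in> sets M"
    "\<And>i B. i \<in> I \<Longrightarrow> B \<in> base \<Longrightarrow> AE x in M. f i x \<in> B \<longleftrightarrow> x \<in> Q i B"
    using vimage openin_base by metis
  define map_code where "map_code i = (SIGMA B:base. code (Q i B))" for i
  have "inj_on map_code I"
  proof (rule inj_onI)
    fix i j assume ij: "i \<in> I" "j \<in> I" "map_code i = map_code j"
    have "AE x in M. f i x \<in> B \<longleftrightarrow> f j x \<in> B" if B: "B \<in> base" for B
    proof -
      have "code (Q i B) = code (Q j B)"
        using ij(3) B by (auto simp: map_code_def set_eq_iff)
      then have "AE x in M. x \<in> Q i B \<longleftrightarrow> x \<in> Q j B"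
        using Q(1) B ij(1,2) by (intro code)
      then show ?thesis
        using Q(2)[OF ij(1) B] Q(2)[OF ij(2) B] by eventually_elim simp
    qed
    then have "AE x in M. f i x = f j x"
      using f ij by (intro AE_eq_if_AE_base_iff)
    then show "i = j"
      using distinct ij by blast
  qed
  moreover have "map_code i \<subseteq> base \<times> UNIV \<times> base" for i
    using range by (auto simp: map_code_def)
  ultimately have "I \<lesssim> Pow (base \<times> (UNIV :: nat set) \<times> base)"
    unfolding lepoll_def by (intro exI[of _ map_code]) auto
  also have "\<dots> \<lesssim> (UNIV :: real set)"
    using countable_base by (intro Pow_countable_lepoll_continuum) auto
  finally show ?thesis .
qed

definition support :: "'x set" where
  "support = {x\<in>space M. \<forall>U. openin T U \<longrightarrow> x \<in> U \<longrightarrow> measure M U \<noteq> 0}"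

lemma compl_support_eq: "space M - support = \<Union>{B\<in>base. measure M B = 0}"
proof
  show "space M - support \<subseteq> \<Union>{B\<in>base. measure M B = 0}"
  proof
    fix x assume "x \<in> space M - support"
    then obtain U where U: "openin T U" "x \<in> U" "measure M U = 0"
      by (auto simp: support_def)
    then obtain B where B: "B \<in> base" "x \<in> B" "B \<subseteq> U"
      using base_neighbourhood by blast
    then have "measure M B \<le> measure M U"
      using U(1) by (intro finite_measure_mono) (auto intro: openin_sets)
    then show "x \<in> \<Union>{B\<in>base. measure M B = 0}"
      using B U(3) by (auto simp: measure_le_0_iff)
  qed
  show "\<Union>{B\<in>base. measure M B = 0} \<subseteq> space M - support"
    using openin_base openin_subset[of T] by (fastforce simp: support_def)
qed

lemma closedin_support: "closedin T support"
proof -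
  have "openin T (space M - support)"
    unfolding compl_support_eq using openin_base by auto
  then show ?thesis
    by (auto simp: closedin_def support_def)
qed

lemma compl_support_null: "space M - support \<in> null_sets M"
proof -
  have "(\<Union>B\<in>{B\<in>base. measure M B = 0}. B) \<in> null_sets M"
    using countable_base
    by (intro null_sets_UN')
       (auto simp: null_sets_def emeasure_eq_measure intro: openin_sets openin_base)
  then show ?thesis
    by (simp add: compl_support_eq)
qed

lemma open_meets_support:
  assumes U: "openin T U" and pos: "measure M U \<noteq> 0"
  shows "U \<inter> support \<noteq> {}"
proof
  assume "U \<inter> support = {}"
  then have "U \<subseteq> space M - support"
    using openin_subset[OF U] by auto
  then have "U \<in> null_sets M"
    by (rule null_sets_subset[OF compl_support_null openin_sets[OF U]])
  then show False
    using pos by (simp add: measure_eq_0_null_sets)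
qed

lemma support_subset_derived_set_of_dense:
  assumes diffuse: "\<And>x. x \<in> space M \<Longrightarrow> {x} \<in> null_sets M"
    and dense: "support \<subseteq> T closure_of D"
  shows "support \<subseteq> T derived_set_of D"
proof
  fix x assume x: "x \<in> support"
  then have xM: "x \<in> space M"
    by (simp add: support_def)
  have "\<exists>y. y \<noteq> x \<and> y \<in> D \<and> y \<in> V" if V: "x \<in> V" "openin T V" for V
  proof -
    have V': "openin T (V - {x})"
      using V closedin_singleton[OF xM] by blast
    have "measure M V \<noteq> 0"
      using x V by (auto simp: support_def)
    then have "measure M (V - {x}) \<noteq> 0"
      using diffuse[OF xM] V by (simp add: measure_Diff_null_set openin_sets)
    then obtain z where z: "z \<in> V - {x}" "z \<in> support"
      using open_meets_support[OF V'] by blast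
    then have "z \<in> T closure_of D"
      using dense by blast
    then have "\<forall>U. z \<in> U \<and> openin T U \<longrightarrow> (\<exists>y. y \<in> D \<and> y \<in> U)"
      by (simp add: in_closure_of)
    then have "\<exists>y. y \<in> D \<and> y \<in> V - {x}"
      using V' z(1) by (elim allE[of _ "V - {x}"]) simp
    then show ?thesis
      by blast
  qed
  then show "x \<in> T derived_set_of D"
    using xM by (simp add: in_derived_set_of)
qed

lemma continuum_lepoll_dense_gdelta_in_support:
  assumes complete: "completely_metrizable_space T" and nonzero: "measure M (space M) \<noteq> 0"
    and diffuse: "\<And>x. x \<in> space M \<Longrightarrow> {x} \<in> null_sets M"
    and S: "gdelta_in T S" "S \<subseteq> support" "support \<subseteq> T closure_of S"
  shows "(UNIV :: real set) \<lesssim> S"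
proof (rule lepoll_perfect_set)
  show "completely_metrizable_space (subtopology T S) \<or>
    locally_compact_space (subtopology T S) \<and> Hausdorff_space (subtopology T S)"
    using completely_metrizable_space_gdelta_in[OF complete S(1)] by simp
  have "S \<subseteq> T derived_set_of S"
    using support_subset_derived_set_of_dense[OF diffuse S(3)] S(2) by auto
  then show "subtopology T S derived_set_of S = S"
    by (auto simp: derived_set_of_subtopology)
  have "support \<noteq> {}"
    using open_meets_support[of "space M"] nonzero openin_topspace[of T] by auto
  then show "S \<noteq> {}"
    using S(3) by auto
qed

theorem null_set_of_size_continuum:
  assumes complete: "completely_metrizable_space T" and nonzero: "measure M (space M) \<noteq> 0"
    and diffuse: "\<And>x. x \<in> space M \<Longrightarrow> {x} \<in> null_sets M"
  obtains N where "N \<in> null_sets M" "(UNIV :: real set) \<lesssim> N"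
proof -
  have "separable_space (subtopology T support)"
    by (intro second_countable_imp_separable_space second_countable_subtopology second_countable)
  then obtain D where D: "countable D" "D \<subseteq> support" "subtopology T support closure_of D = support"
    using closedin_subset[OF closedin_support] by (auto simp: separable_space_def inf.absorb2)
  have "(\<Union>x\<in>D. {x}) \<in> null_sets M"
    using D(1,2) diffuse by (intro null_sets_UN') (auto simp: support_def)
  then have D_null: "D \<in> null_sets M"
    by simp
  then obtain S where S: "gdelta_in T S" "D \<subseteq> S" "S - D \<in> null_sets M"
    using gdelta_hull by blast
  have "D \<union> (S - D) \<in> null_sets M"
    using D_null S(3) by (rule null_sets.Un)
  then have "S \<in> null_sets M"
    using S(2) by (simp add: Un_absorb1)
  then have "S \<inter> support \<in> null_sets M"
    using closedin_sets[OF closedin_support] by (rule null_set_Int2)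
  moreover have "(UNIV :: real set) \<lesssim> S \<inter> support"
  proof (rule continuum_lepoll_dense_gdelta_in_support[OF complete nonzero diffuse])
    show "gdelta_in T (S \<inter> support)"
      using S(1) closed_imp_gdelta_in[OF metrizable closedin_support] by (rule gdelta_in_Int)
    have "support \<subseteq> T closure_of D"
      using D(3) by (simp add: closure_of_subtopology Int_absorb1[OF D(2)] inf.absorb_iff1)
    also have "\<dots> \<subseteq> T closure_of (S \<inter> support)"
      using D(2) S(2) by (intro closure_of_mono) auto
    finally show "support \<subseteq> T closure_of (S \<inter> support)" .
  qed auto
  ultimately show ?thesis
    by (rule that)
qed

end

lemma standard_borel_imp_polish:
  assumes "finite_measure M" "standard_borel M"
  obtains T where "second_countable_borel_measure M T" "completely_metrizable_space T"
proof -
  obtain T where T: "completely_metrizable_space T" "separable_space T" "topspace T = space M"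
    "sets M = sigma_sets (space M) {U. openin T U}"
    using assms(2) by (auto simp: standard_borel_def polish_topology_def)
  then have metrizable: "metrizable_space T"
    by (intro completely_metrizable_imp_metrizable_space)
  then have "second_countable T"
    using T(2) by (rule separable_metrizable_imp_second_countable)
  with assms(1) T metrizable show ?thesis
    by (intro that[of T] second_countable_borel_measure.intro
        second_countable_borel_measure_axioms.intro metrizable_borel_measure.intro metrizable_borel_measure_axioms.intro)
qed

lemma non_atomic_imp_singleton_null:
  assumes "non_atomic M" "{x} \<in> sets M"
  shows "{x} \<in> null_sets M"
proof (rule ccontr)
  assume "{x} \<notin> null_sets M"
  then have "0 < emeasure M {x}"
    using assms(2) by (simp add: null_sets_def zero_less_iff_neq_zero)
  then obtain B where "B \<subseteq> {x}" "0 < emeasure M B" "emeasure M B < emeasure M {x}"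
    using assms by (auto simp: non_atomic_def)
  then show False
    by (auto simp: subset_singleton_iff)
qed

section \<open>Near-actions\<close>

lemma image_measure_preserving_null:
  assumes "image_measure_preserving M f" "Z \<in> null_sets M"
  shows "f ` Z \<in> null_sets (completion M)"
  using assms by (auto simp: image_measure_preserving_def null_sets_def)

lemma (in finite_measure) image_measure_preserving_conull:
  assumes f: "image_measure_preserving M f" and Z: "Z \<in> null_sets M"
  shows "space M - f ` (space M - Z) \<in> null_sets (completion M)"
proof -
  let ?Y = "f ` (space M - Z)"
  have "space M - Z \<in> sets M"
    using Z by auto
  then have Y: "?Y \<in> sets (completion M)" "emeasure (completion M) ?Y = emeasure M (space M)"
    using f emeasure_Diff_null_set[OF Z sets.top] unfolding image_measure_preserving_def by metis+
  then have "emeasure (completion M) (space (completion M) - ?Y) = 0"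
    by (subst emeasure_compl) auto
  then show ?thesis
    using Y(1) by (auto simp: null_sets_def)
qed

lemma (in finite_measure) bij_image_null_if_eq_off_null:
  assumes f: "image_measure_preserving M f" and r: "bij_betw r (space M) (space M)"
    and Z: "Z \<in> null_sets M" and eq: "\<And>x. x \<in> space M - Z \<Longrightarrow> f x = r x"
  shows "r ` Z \<in> null_sets (completion M)"
proof -
  have "Z \<subseteq> space M"
    using Z by (simp add: null_sets_def sets.sets_into_space)
  then have "r ` Z = r ` space M - r ` (space M - Z)"
    using r inj_on_image_set_diff[of r "space M" "space M" "space M - Z"]
    by (auto simp: bij_betw_def double_diff)
  also have "r ` (space M - Z) = f ` (space M - Z)"
    using eq by (intro image_cong) auto
  finally show ?thesis
    using image_measure_preserving_conull[OF f Z] r by (simp add: bij_betw_def)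
qed

lemma (in finite_measure) image_measure_preserving_AE_cong:
  assumes f: "image_measure_preserving M f" and eq: "AE x in M. f x = r x"
    and r: "bij_betw r (space M) (space M)"
  shows "image_measure_preserving M r"
  unfolding image_measure_preserving_def
proof
  obtain Z where Z: "{x\<in>space M. f x \<noteq> r x} \<subseteq> Z" "Z \<in> null_sets M"
    using eq by (auto elim!: AE_E)
  fix B assume B: "B \<in> sets M"
  have "r ` Z \<in> null_sets (completion M)"
    using Z by (intro bij_image_null_if_eq_off_null[OF f r]) auto
  then have null: "r ` (B \<inter> Z) \<in> null_sets (completion M)"
    by (rule null_sets_completion_subset[rotated]) auto
  have "r ` B = r ` (B - Z) \<union> r ` (B \<inter> Z)"
    by blast
  also have "r ` (B - Z) = f ` (B - Z)"
    using Z(1) sets.sets_into_space[OF B] by (intro image_cong) auto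
  finally have r_image: "r ` B = f ` (B - Z) \<union> r ` (B \<inter> Z)" .
  have "B - Z \<in> sets M"
    using B Z(2) by auto
  then have "f ` (B - Z) \<in> sets (completion M)"
    "emeasure (completion M) (f ` (B - Z)) = emeasure M B"
    using f emeasure_Diff_null_set[OF Z(2) B] unfolding image_measure_preserving_def by metis+
  then show "r ` B \<in> sets (completion M) \<and> emeasure (completion M) (r ` B) = emeasure M B"
    unfolding r_image using null by (metis emeasure_Un_null_set null_setsD2 sets.Un)
qed

lemma spatial_model_pullback:
  assumes G: "group G" and p: "p \<in> hom G H" and \<rho>: "spatial_model H M \<eta>' \<rho>"
    and eq: "\<And>g. g \<in> carrier G \<Longrightarrow> AE x in M. \<eta> g x = \<eta>' (p g) x"
  shows "spatial_model G M \<eta> (\<lambda>g. \<rho> (p g))"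
  unfolding spatial_model_def
proof (intro conjI ballI)
  have p_carrier: "p g \<in> carrier H" if "g \<in> carrier G" for g
    using p that by (rule hom_in_carrier)
  have "\<rho> \<in> hom H (BijGroup (space M))"
    using \<rho> by (simp add: spatial_model_def group_action_def group_hom_def group_hom_axioms_def)
  then have "(\<lambda>g. \<rho> (p g)) \<in> hom G (BijGroup (space M))"
    using hom_compose[OF p] by (simp add: o_def)
  then show "group_action G (space M) (\<lambda>g. \<rho> (p g))"
    using G by (simp add: group_action_def group_hom_def group_hom_axioms_def group_BijGroup)
  fix g assume g: "g \<in> carrier G"
  show "image_measure_preserving M (\<rho> (p g))"
    using \<rho> p_carrier[OF g] by (simp add: spatial_model_def)
  have "AE x in M. \<eta>' (p g) x = \<rho> (p g) x"
    using \<rho> p_carrier[OF g] by (simp add: spatial_model_def)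
  with eq[OF g] show "AE x in M. \<eta> g x = \<rho> (p g) x"
    by eventually_elim simp
qed

locale near_action = finite_measure M + group G
  for M :: "'x measure" and G :: "('g, 'b) monoid_scheme" (structure) +
  fixes \<eta> :: "'g \<Rightarrow> 'x \<Rightarrow> 'x"
  assumes near_action: "measure_preserving_near_action G M \<eta>"
begin

lemma maps_space: "g \<in> carrier G \<Longrightarrow> \<eta> g \<in> space M \<rightarrow> space M"
  and AE_one: "AE x in M. \<eta> \<one> x = x"
  and AE_mult: "g \<in> carrier G \<Longrightarrow> h \<in> carrier G \<Longrightarrow> AE x in M. \<eta> (g \<otimes> h) x = \<eta> g (\<eta> h x)"
  and image_preserving: "g \<in> carrier G \<Longrightarrow> image_measure_preserving M (\<eta> g)"
  using near_action by (auto simp: measure_preserving_near_action_def)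

lemma AE_inv_cancel: "g \<in> carrier G \<Longrightarrow> AE x in M. \<eta> (inv g) (\<eta> g x) = x"
  using AE_mult[of "inv g" g] AE_one by (auto elim!: eventually_elim2)

lemma AE_inv_cancel': "g \<in> carrier G \<Longrightarrow> AE x in M. \<eta> g (\<eta> (inv g) x) = x"
  using AE_inv_cancel[of "inv g"] by simp

text \<open>Only forward images are controlled, but preimages under \<open>\<eta> g\<close> are, up to null sets, forward
  images under \<open>\<eta> (inv g)\<close>.\<close>

lemma AE_vimage_iff_image_inv:
  assumes g: "g \<in> carrier G" and B: "B \<subseteq> space M"
  shows "AE x in M. \<eta> g x \<in> B \<longleftrightarrow> x \<in> \<eta> (inv g) ` B"
proof -
  obtain Z where Z: "{x\<in>space M. \<eta> g (\<eta> (inv g) x) \<noteq> x} \<subseteq> Z" "Z \<in> null_sets M"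
    using AE_inv_cancel'[OF g] by (auto elim!: AE_E)
  have "\<eta> (inv g) ` Z \<in> null_sets (completion M)"
    using g Z(2) by (intro image_measure_preserving_null image_preserving) auto
  then have "AE x in M. x \<notin> \<eta> (inv g) ` Z"
    using AE_not_in AE_completion_iff by blast
  with AE_inv_cancel[OF g] show ?thesis
  proof eventually_elim
    case (elim x)
    have "\<eta> g x \<in> B" if "y \<in> B" "x = \<eta> (inv g) y" for y
    proof -
      have "y \<in> space M" "y \<notin> Z"
        using that elim(2) B by auto
      then show ?thesis
        using Z(1) that by auto
    qed
    moreover have "x \<in> \<eta> (inv g) ` B" if "\<eta> g x \<in> B"
      using elim(1) that by (metis image_eqI)
    ultimately show ?case
      by blast
  qed
qed

lemma AE_vimage_iff_event:
  assumes g: "g \<in> carrier G" and B: "B \<in> sets M"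
  shows "\<exists>Q\<in>sets M. AE x in M. \<eta> g x \<in> B \<longleftrightarrow> x \<in> Q"
proof -
  have image: "\<eta> (inv g) ` B \<in> sets (completion M)"
    using image_preserving[of "inv g"] g B by (auto simp: image_measure_preserving_def)
  have "AE x in M. \<eta> g x \<in> B \<longleftrightarrow> x \<in> main_part M (\<eta> (inv g) ` B)"
    using AE_vimage_iff_image_inv[OF g sets.sets_into_space[OF B]] AE_in_main_part[OF image]
    by eventually_elim simp
  then show ?thesis
    using image by blast
qed

lemma AE_not_in_null:
  assumes g: "g \<in> carrier G" and Z: "Z \<in> null_sets M"
  shows "AE x in M. \<eta> g x \<notin> Z"
proof -
  have "\<eta> (inv g) ` Z \<in> null_sets (completion M)"
    using g Z by (intro image_measure_preserving_null image_preserving) auto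
  then have "AE x in M. x \<notin> \<eta> (inv g) ` Z"
    using AE_not_in AE_completion_iff by blast
  moreover have "Z \<subseteq> space M"
    using Z by (simp add: null_sets_def sets.sets_into_space)
  then have "AE x in M. \<eta> g x \<in> Z \<longleftrightarrow> x \<in> \<eta> (inv g) ` Z"
    by (rule AE_vimage_iff_image_inv[OF g])
  ultimately show ?thesis
    by eventually_elim simp
qed

lemma AE_translate:
  assumes g: "g \<in> carrier G" and P: "AE x in M. P x"
  shows "AE x in M. P (\<eta> g x)"
proof -
  obtain Z where Z: "{x\<in>space M. \<not> P x} \<subseteq> Z" "Z \<in> null_sets M"
    using P by (auto elim!: AE_E)
  show ?thesis
    using AE_not_in_null[OF g Z(2)] AE_space by eventually_elim (use Z(1) maps_space[OF g] in auto)
qed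

definition ae_kernel :: "'g set" where
  "ae_kernel = {g \<in> carrier G. AE x in M. \<eta> g x = x}"

lemma AE_eq_iff_ae_kernel:
  assumes g: "g \<in> carrier G" and h: "h \<in> carrier G"
  shows "(AE x in M. \<eta> g x = \<eta> h x) \<longleftrightarrow> g \<otimes> inv h \<in> ae_kernel"
proof
  assume "AE x in M. \<eta> g x = \<eta> h x"
  then have "AE x in M. \<eta> g (\<eta> (inv h) x) = \<eta> h (\<eta> (inv h) x)"
    using h by (intro AE_translate) auto
  moreover have "AE x in M. \<eta> (g \<otimes> inv h) x = \<eta> g (\<eta> (inv h) x)"
    using g h by (intro AE_mult) auto
  moreover note AE_inv_cancel'[OF h]
  ultimately have "AE x in M. \<eta> (g \<otimes> inv h) x = x"
    by eventually_elim simp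
  then show "g \<otimes> inv h \<in> ae_kernel"
    using g h by (simp add: ae_kernel_def)
next
  assume "g \<otimes> inv h \<in> ae_kernel"
  then have "AE x in M. \<eta> (g \<otimes> inv h) (\<eta> h x) = \<eta> h x"
    using h by (intro AE_translate) (auto simp: ae_kernel_def)
  moreover have "AE x in M. \<eta> (g \<otimes> inv h \<otimes> h) x = \<eta> (g \<otimes> inv h) (\<eta> h x)"
    using g h by (intro AE_mult) auto
  moreover have "g \<otimes> inv h \<otimes> h = g"
    using g h by (simp add: m_assoc)
  ultimately show "AE x in M. \<eta> g x = \<eta> h x"
    by (auto elim!: eventually_elim2)
qed

lemma subgroup_ae_kernel: "subgroup ae_kernel G"
proof (rule subgroupI)
  show "ae_kernel \<subseteq> carrier G" "ae_kernel \<noteq> {}"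
    using AE_one by (auto simp: ae_kernel_def)
  show "inv g \<in> ae_kernel" if "g \<in> ae_kernel" for g
  proof -
    have g: "g \<in> carrier G" and "AE x in M. \<eta> g x = x"
      using that by (auto simp: ae_kernel_def)
    then have "AE x in M. \<eta> \<one> x = \<eta> g x"
      using AE_one by (auto elim!: eventually_elim2)
    then show ?thesis
      using g by (simp add: AE_eq_iff_ae_kernel)
  qed
  show "g \<otimes> h \<in> ae_kernel" if "g \<in> ae_kernel" "h \<in> ae_kernel" for g h
  proof -
    have gh: "g \<in> carrier G" "h \<in> carrier G" and "AE x in M. \<eta> g x = x" "AE x in M. \<eta> h x = x"
      using that by (auto simp: ae_kernel_def)
    with AE_mult[OF gh] have "AE x in M. \<eta> (g \<otimes> h) x = x"
      by (auto elim!: eventually_elim2)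
    then show ?thesis
      using gh by (simp add: ae_kernel_def)
  qed
qed

lemma ae_kernel_normal: "ae_kernel \<lhd> G"
  unfolding normal_inv_iff
proof (intro conjI ballI subgroup_ae_kernel)
  fix g k assume g: "g \<in> carrier G" and k: "k \<in> ae_kernel"
  then have kG: "k \<in> carrier G" and "AE x in M. \<eta> k x = x"
    by (auto simp: ae_kernel_def)
  with AE_mult[OF g kG] have "AE x in M. \<eta> (g \<otimes> k) x = \<eta> g x"
    by (auto elim!: eventually_elim2)
  then show "g \<otimes> k \<otimes> inv g \<in> ae_kernel"
    using g kG by (simp add: AE_eq_iff_ae_kernel)
qed

lemma rcoset_ae_kernel_eq_iff:
  assumes "g \<in> carrier G" "h \<in> carrier G"
  shows "ae_kernel #> g = ae_kernel #> h \<longleftrightarrow> (AE x in M. \<eta> g x = \<eta> h x)"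
proof -
  have "ae_kernel #> g = ae_kernel #> h \<longleftrightarrow> g \<in> ae_kernel #> h"
    using assms subgroup_ae_kernel rcos_self repr_independence by metis
  also have "\<dots> \<longleftrightarrow> g \<otimes> inv h \<in> ae_kernel"
    using assms subgroup.rcos_module[OF subgroup_ae_kernel group_axioms] by blast
  finally show ?thesis
    by (simp add: AE_eq_iff_ae_kernel assms)
qed

lemma near_action_section:
  assumes H: "group H" and p: "p \<in> hom G H" and s: "s \<in> carrier H \<rightarrow> carrier G"
    and right_inv: "\<And>h. h \<in> carrier H \<Longrightarrow> p (s h) = h"
    and eq: "\<And>g. g \<in> carrier G \<Longrightarrow> AE x in M. \<eta> g x = \<eta> (s (p g)) x"
  shows "near_action M H (\<lambda>h. \<eta> (s h))"
proof -
  have s_carrier: "s h \<in> carrier G" if "h \<in> carrier H" for h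
    using s that by blast
  have "AE x in M. \<eta> (s \<one>\<^bsub>H\<^esub>) x = x"
    using eq[OF one_closed] AE_one unfolding hom_one[OF p group_axioms H] by eventually_elim simp
  moreover have "AE x in M. \<eta> (s (g \<otimes>\<^bsub>H\<^esub> h)) x = \<eta> (s g) (\<eta> (s h) x)"
    if gh: "g \<in> carrier H" "h \<in> carrier H" for g h
  proof -
    have "p (s g \<otimes> s h) = g \<otimes>\<^bsub>H\<^esub> h"
      using gh by (simp add: hom_mult[OF p] s_carrier right_inv)
    then show ?thesis
      using eq[of "s g \<otimes> s h"] AE_mult[of "s g" "s h"] s_carrier gh
      by (auto elim!: eventually_elim2)
  qed
  ultimately have "measure_preserving_near_action H M (\<lambda>h. \<eta> (s h))"
    using s_carrier maps_space image_preserving by (simp add: measure_preserving_near_action_def)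
  then show ?thesis
    by (intro near_action.intro near_action_axioms.intro finite_measure_axioms H)
qed

definition coset_rep :: "'g set \<Rightarrow> 'g" where
  "coset_rep = inv_into (carrier G) (\<lambda>g. ae_kernel #> g)"

lemma coset_rep_carrier: "C \<in> carrier (G Mod ae_kernel) \<Longrightarrow> coset_rep C \<in> carrier G"
  and rcoset_coset_rep: "C \<in> carrier (G Mod ae_kernel) \<Longrightarrow> ae_kernel #> coset_rep C = C"
  unfolding coset_rep_def carrier_FactGroup
  by (auto intro: inv_into_into simp: f_inv_into_f[where f = "\<lambda>g. ae_kernel #> g"])

lemma AE_eq_coset_rep:
  assumes g: "g \<in> carrier G"
  shows "AE x in M. \<eta> g x = \<eta> (coset_rep (ae_kernel #> g)) x"
proof -
  have "ae_kernel #> g \<in> carrier (G Mod ae_kernel)"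
    using g by (auto simp: carrier_FactGroup)
  then show ?thesis
    using g rcoset_ae_kernel_eq_iff coset_rep_carrier rcoset_coset_rep by metis
qed

lemma near_action_Mod: "near_action M (G Mod ae_kernel) (\<lambda>C. \<eta> (coset_rep C))"
  by (rule near_action_section[OF normal.factorgroup_is_group[OF ae_kernel_normal]
        normal.r_coset_hom_Mod[OF ae_kernel_normal]])
     (auto simp: coset_rep_carrier rcoset_coset_rep AE_eq_coset_rep)

lemma spatial_model_from_Mod:
  assumes "spatial_model (G Mod ae_kernel) M (\<lambda>C. \<eta> (coset_rep C)) \<rho>"
  shows "spatial_model G M \<eta> (\<lambda>g. \<rho> (ae_kernel #> g))"
  using group_axioms normal.r_coset_hom_Mod[OF ae_kernel_normal] assms AE_eq_coset_rep
  by (rule spatial_model_pullback)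

lemma Mod_lepoll_continuum:
  assumes "second_countable_borel_measure M T"
  shows "carrier (G Mod ae_kernel) \<lesssim> (UNIV :: real set)"
proof -
  interpret second_countable_borel_measure M T
    by (rule assms)
  show ?thesis
  proof (rule AE_distinct_maps_lepoll_continuum)
    fix C assume C: "C \<in> carrier (G Mod ae_kernel)"
    show "\<eta> (coset_rep C) \<in> space M \<rightarrow> space M"
      by (rule maps_space[OF coset_rep_carrier[OF C]])
    show "\<exists>Q\<in>sets M. AE x in M. \<eta> (coset_rep C) x \<in> B \<longleftrightarrow> x \<in> Q" if "openin T B" for B
      by (rule AE_vimage_iff_event[OF coset_rep_carrier[OF C] openin_sets[OF that]])
    show "C = D" if "D \<in> carrier (G Mod ae_kernel)"
      "AE x in M. \<eta> (coset_rep C) x = \<eta> (coset_rep D) x" for D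
      using rcoset_ae_kernel_eq_iff[OF coset_rep_carrier[OF C] coset_rep_carrier[OF that(1)]] that
      by (simp add: rcoset_coset_rep C)
  qed
qed

lemma AE_acts_at:
  assumes M: "null_additive_below_continuum M" and N: "N \<in> null_sets M"
    and H: "H \<subseteq> carrier G" "H \<prec> (UNIV :: real set)"
  shows "AE x in M. acts_at G \<eta> (space M - N) H x"
proof -
  have HG: "g \<in> carrier G" if "g \<in> H" for g
    using that H(1) by blast
  have "AE x in M. \<forall>g\<in>H. \<eta> g x \<notin> N"
    using AE_not_in_null[OF HG N] by (rule AE_ball_below_continuum[OF M H(2)])
  moreover have "AE x in M. \<forall>g\<in>H. \<forall>h\<in>H. \<eta> (g \<otimes> h) x = \<eta> g (\<eta> h x)"
    using AE_mult[OF HG HG] by (intro AE_ball_below_continuum[OF M H(2)])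
  ultimately show ?thesis
    using AE_one AE_space by eventually_elim 
      (use maps_space[OF HG, THEN funcset_mem] in \<open>auto simp: acts_at_def\<close>)
qed

lemma ex_group_action_AE_eq:
  assumes M: "null_additive_below_continuum M"
    and G: "carrier G \<lesssim> (UNIV :: real set)" and X: "space M \<lesssim> (UNIV :: real set)"
    and N: "N \<in> null_sets M" "(UNIV :: real set) \<lesssim> N"
  shows "\<exists>\<rho>. group_action G (space M) \<rho> \<and> (\<forall>g\<in>carrier G. AE x in M. \<eta> g x = \<rho> g x)"
proof -
  obtain \<C> where \<C>: "subgroup_chain G \<C>" "\<Union>\<C> = carrier G" "\<forall>H\<in>\<C>. H \<prec> (UNIV :: real set)"
    using ex_small_subgroup_chain[OF uncountable_UNIV_real G] by blast
  have "space M - N \<lesssim> (UNIV :: real set)"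
    using X by (rule lepoll_trans[OF subset_imp_lepoll, rotated]) auto
  then have "carrier G \<times> (space M - N) \<lesssim> (UNIV :: real set)"
    using G by (intro Times_lepoll_infinite infinite_UNIV_char_0)
  also note N(2)
  also have "N \<lesssim> space M - (space M - N)"
    using sets.sets_into_space[OF null_setsD2[OF N(1)]] by (intro subset_imp_lepoll) auto
  finally have room: "carrier G \<times> (space M - N) \<lesssim> space M - (space M - N)" .
  obtain \<rho> where \<rho>: "group_action G (space M) \<rho>"
    and extends: "\<forall>H\<in>\<C>. \<forall>g\<in>H. \<forall>x. acts_at G \<eta> (space M - N) H x \<longrightarrow> \<rho> g x = \<eta> g x"
    using subgroup_chain.group_action_extending_acts_at[OF \<C>(1) Diff_subset room] by blast
  have "AE x in M. \<eta> g x = \<rho> g x" if "g \<in> carrier G" for g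
  proof -
    have "g \<in> \<Union>\<C>"
      using that \<C>(2) by simp
    then obtain H where H: "H \<in> \<C>" "g \<in> H"
      by blast
    then have "AE x in M. acts_at G \<eta> (space M - N) H x"
      using \<C>(2,3) by (intro AE_acts_at[OF M N(1)]) auto
    then show ?thesis
      by eventually_elim (use extends H in auto)
  qed
  with \<rho> show ?thesis
    by blast
qed

theorem spatial_model_if_small:
  assumes "null_additive_below_continuum M"
    and "carrier G \<lesssim> (UNIV :: real set)" and "space M \<lesssim> (UNIV :: real set)"
    and "N \<in> null_sets M" and "(UNIV :: real set) \<lesssim> N"
  shows "\<exists>\<rho>. spatial_model G M \<eta> \<rho>"
proof -
  obtain \<rho> where \<rho>: "group_action G (space M) \<rho>" "\<forall>g\<in>carrier G. AE x in M. \<eta> g x = \<rho> g x"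
    using ex_group_action_AE_eq[OF assms] by blast
  have "image_measure_preserving M (\<rho> g)" if g: "g \<in> carrier G" for g
  proof (rule image_measure_preserving_AE_cong[OF image_preserving[OF g] bspec[OF \<rho>(2) g]])
    show "bij_betw (\<rho> g) (space M) (space M)"
      using group_action.bij_prop0[OF \<rho>(1) g] by (simp add: Bij_def)
  qed
  then show ?thesis
    using \<rho> by (auto simp: spatial_model_def)
qed

end

theorem theorem1p5:
  fixes M :: "'x measure" and G :: "('g, 'b) monoid_scheme"
  assumes "martins_axiom TYPE(real)"
    and "prob_space M" and "standard_borel M" and "non_atomic M"
    and "group G"
  shows "\<forall>\<eta>. measure_preserving_near_action G M \<eta> \<longrightarrow> (\<exists>\<rho>. spatial_model G M \<eta> \<rho>)"
proof (intro allI impI)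
  fix \<eta> assume \<eta>: "measure_preserving_near_action G M \<eta>"
  interpret prob_space M
    by (rule assms(2))
  obtain T where T: "second_countable_borel_measure M T" "completely_metrizable_space T"
    by (rule standard_borel_imp_polish[OF finite_measure_axioms assms(3)])
  interpret second_countable_borel_measure M T
    by (rule T(1))
  interpret near_action M G \<eta>
    using assms(5) \<eta> by (intro near_action.intro near_action_axioms.intro finite_measure_axioms)
  have "{x} \<in> null_sets M" if "x \<in> space M" for x
    using assms(4) closedin_sets[OF closedin_singleton[OF that]]
    by (rule non_atomic_imp_singleton_null)
  then obtain N where N: "N \<in> null_sets M" "(UNIV :: real set) \<lesssim> N"
    using null_set_of_size_continuum[OF T(2)] prob_space by (metis zero_neq_one)
  obtain \<rho> where "spatial_model (G Mod ae_kernel) M (\<lambda>C. \<eta> (coset_rep C)) \<rho>"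
    using near_action.spatial_model_if_small[OF near_action_Mod
        martins_axiom_imp_null_additive[OF assms(1)] Mod_lepoll_continuum[OF T(1)] space_lepoll_continuum N] by blast
  then show "\<exists>\<rho>. spatial_model G M \<eta> \<rho>"
    using spatial_model_from_Mod by blast
qed

end
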